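(* Let $F\in\mathcal{A}(\mathbb{C}_p)\setminus\mathbb{C}_p[X]$ be such that, for every $\beta\in\mathbb{C}_p$, the function $F-\beta$ has at most one multiple zero. Then $F$ is prime.
   Context: $p$ is a prime number and $\mathbb{C}_p$ is the completion of an algebraic closure of the field $\mathbb{Q}_p$ of $p$-adic numbers, with the usual $p$-adic absolute value. $\mathcal{A}(\mathbb{C}_p)$ is the algebra of entire functions on $\mathbb{C}_p$ (power series over $\mathbb{C}_p$ converging on all of $\mathbb{C}_p$), and $\mathcal{M}(\mathbb{C}_p)$, the field of meromorphic functions in $\mathbb{C}_p$, is its field of fractions. A linear rational function is one of the form $(ax+b)/(cx+d)$ with $ad-bc\neq0$. A function $F\in\mathcal{M}(\mathbb{C}_p)$ is prime if every factorization $F=f\circ g$ with $f,g\in\mathcal{M}(\mathbb{C}_p)$ implies that $f$ or $g$ is a linear rational function. *)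

theory Defs
  imports "HOL-Analysis.Analysis" "HOL-Computational_Algebra.Computational_Algebra"
begin

class nonarch_complete_field = field_char_0 + complete_space +
  fixes absval :: "'a \<Rightarrow> real"
  assumes dist_absval: "dist x y = absval (x - y)"
    and absval_mult: "absval (x * y) = absval x * absval y"
    and absval_add: "absval (x + y) \<le> max (absval x) (absval y)"

definition padic_abs :: "nat \<Rightarrow> rat \<Rightarrow> real" where
  "padic_abs p x = (if x = 0 then 0 else
     real p powi (int (multiplicity (int p) (snd (quotient_of x)))
                  - int (multiplicity (int p) (fst (quotient_of x)))))"

(* When absval extends the p-adic absolute value of the rationals, this closure is Q_p:
   the ambient field is complete, so the closure is a completion of the rationals. *)
definition Qp :: "'a::nonarch_complete_field set" where
  "Qp = closure (range of_rat)"

definition algebraic_elements :: "'a::field set \<Rightarrow> 'a set" where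
  "algebraic_elements S = {x. \<exists>q. q \<noteq> 0 \<and> set (coeffs q) \<subseteq> S \<and> poly q x = 0}"

definition algebraically_closed_subset :: "'a::field set \<Rightarrow> bool" where
  "algebraically_closed_subset S \<longleftrightarrow>
     (\<forall>q. degree q > 0 \<and> set (coeffs q) \<subseteq> S \<longrightarrow> (\<exists>x\<in>S. poly q x = 0))"

(* C_p is described up to isometric isomorphism, since a type cannot depend on p:
   the complete field 'a contains Q_p, the elements of 'a that are algebraic over Q_p form
   an algebraic closure of Q_p, and they are dense in 'a. *)
definition is_Cp :: "nat \<Rightarrow> 'a::nonarch_complete_field itself \<Rightarrow> bool" where
  "is_Cp p (K :: 'a itself) \<longleftrightarrow>
     (\<forall>x. absval (of_rat x :: 'a) = padic_abs p x) \<and>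
     algebraically_closed_subset (algebraic_elements (Qp :: 'a set)) \<and>
     closure (algebraic_elements (Qp :: 'a set)) = UNIV"

definition entire :: "'a::nonarch_complete_field fps set" where
  "entire = {f. \<forall>z. summable (\<lambda>n. fps_nth f n * z ^ n)}"

definition entire_eval :: "'a::nonarch_complete_field fps \<Rightarrow> 'a \<Rightarrow> 'a" where
  "entire_eval f z = (\<Sum>n. fps_nth f n * z ^ n)"

definition zero_of_order :: "'a::nonarch_complete_field fps \<Rightarrow> 'a \<Rightarrow> nat \<Rightarrow> bool" where
  "zero_of_order f a k \<longleftrightarrow>
     (\<exists>g\<in>entire. f = (fps_X - fps_const a) ^ k * g \<and> entire_eval g a \<noteq> 0)"

definition multiple_zero :: "'a::nonarch_complete_field fps \<Rightarrow> 'a \<Rightarrow> bool" where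
  "multiple_zero f a \<longleftrightarrow> (\<exists>k\<ge>2. zero_of_order f a k)"

(* The field of fractions of the ring of entire functions, realised inside the field of
   fractions of the ring of all formal power series. *)
definition meromorphic_Cp :: "'a::nonarch_complete_field fps fract set" where
  "meromorphic_Cp = {Fract f g | f g. f \<in> entire \<and> g \<in> entire \<and> g \<noteq> 0}"

definition mero_value :: "'a::nonarch_complete_field fps fract \<Rightarrow> 'a \<Rightarrow> 'a \<Rightarrow> bool" where
  "mero_value m z w \<longleftrightarrow>
     (\<exists>f\<in>entire. \<exists>g\<in>entire. m = Fract f g \<and> entire_eval g z \<noteq> 0 \<and>
        w = entire_eval f z / entire_eval g z)"

(* Meromorphic functions take values in the projective line; None is the point at infinity.
   Common zeros of numerator and denominator can be cancelled, so the value None occurs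
   exactly at the poles. *)
definition mero_eval :: "'a::nonarch_complete_field fps fract \<Rightarrow> 'a \<Rightarrow> 'a option" where
  "mero_eval m z = (if \<exists>w. mero_value m z w then Some (THE w. mero_value m z w) else None)"

(* F = f o g. The equation is between points of the projective line, and it is required
   wherever g is finite, hence outside a discrete set. At a pole of g the value f(infinity)
   need not exist; if f is rational, it exists and the equation there follows by continuity.
   If g is constant and equal to a pole of f, the right-hand side is constantly infinity,
   so the relation fails for every F. *)
definition is_composition ::
  "'a::nonarch_complete_field fps fract \<Rightarrow> 'a fps fract \<Rightarrow> 'a fps fract \<Rightarrow> bool" where
  "is_composition F f g \<longleftrightarrow>
     (\<forall>z w. mero_eval g z = Some w \<longrightarrow> mero_eval F z = mero_eval f w)"

definition linear_rational :: "'a::nonarch_complete_field fps fract \<Rightarrow> bool" where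
  "linear_rational m \<longleftrightarrow>
     (\<exists>a b c d. a * d - b * c \<noteq> 0 \<and>
        m = Fract (fps_of_poly [:b, a:]) (fps_of_poly [:d, c:]))"

definition prime_meromorphic :: "'a::nonarch_complete_field fps fract \<Rightarrow> bool" where
  "prime_meromorphic F \<longleftrightarrow> F \<in> meromorphic_Cp \<and>
     (\<forall>f\<in>meromorphic_Cp. \<forall>g\<in>meromorphic_Cp.
        is_composition F f g \<longrightarrow> linear_rational f \<or> linear_rational g)"

end

(* Everything rests on one fact: for an entire h and R > 0, let \<nu> be the last index n at which
   |h_n| R^n is maximal; if \<nu> > 0, then h has a zero of absolute value at most R. Hence a nonconstant
   entire function is surjective, one with finitely many zeros is a polynomial, and a meromorphic
   function without poles is entire.

   Let F = H o G with H and G entire. If c is a zero of H', every point of the fibre G^-1(c) is a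
   multiple zero of F - H(c), so the fibre has at most one point. If G is transcendental, all its
   fibres are infinite, so H' has no zero and H is linear. If G is a polynomial of degree at least 2,
   then H' has infinitely many zeros, but only one fibre of G can be a single point.

   Let F = f o g with g having a pole. Then g attains all large values on a bounded set, so f is
   bounded near infinity; as f is not constant, it has a pole a, which g omits. Thus g = a + 1/h with h
   entire, a is the only pole of f, and t |-> f(a + 1/t) is a polynomial T with F = T o h, which
   reduces to the entire case. *)
theory Submission
  imports Defs
begin

text \<open>Three obstacles shape the proof. \<open>is_Cp\<close> only says that the algebraic
  elements are algebraically closed and dense, so roots of polynomials over the completed field have
  to be produced by approximation; the locale \<open>nonarch_alg_closed\<close> isolates what the
  rest uses: such roots, and an element of absolute value strictly between 0 and 1. The field is not
  locally compact, so zeros are not found by compactness but as limits of sequences with controlled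
  steps. And a composition is given by its values alone: neither a chain rule nor a substitution of
  power series is at hand, so multiplicities are recovered by dividing out linear factors, by
  continuity and by the identity principle.

  All estimates are in terms of |h_n| R^n. The index \<nu> is taken to be the last maximal one
  because dividing h by X - z, for a zero z in the disc, then lowers it by exactly one; the
  arguments that remove zeros in a disc are inductions on it.\<close>

unbundle no vec_syntax
unbundle fps_syntax

section \<open>Non-archimedean absolute values\<close>

lemma absval_0 [simp]: "absval 0 = 0"
  using dist_absval[of 0 0] by simp

lemma absval_nonneg [simp]: "0 \<le> absval x"
  using dist_absval[of x 0] zero_le_dist[of x 0] by simp

lemma absval_eq_0_iff [simp]: "absval x = 0 \<longleftrightarrow> x = 0"
  using dist_absval[of x 0] dist_eq_0_iff[of x 0] by simp

lemma absval_pos_iff [simp]: "0 < absval x \<longleftrightarrow> x \<noteq> 0"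
  using absval_nonneg[of x] absval_eq_0_iff[of x] by linarith

lemma absval_1 [simp]: "absval 1 = 1"
  using absval_mult[of 1 1] absval_eq_0_iff[of 1] by simp

lemma absval_minus_commute: "absval (x - y) = absval (y - x)"
  using dist_absval[of x y] dist_absval[of y x] dist_commute[of x y] by simp

lemma absval_minus [simp]: "absval (- x) = absval x"
  using absval_minus_commute[of 0 x] by simp

lemma absval_diff: "absval (x - y) \<le> max (absval x) (absval y)"
  using absval_add[of x "- y"] by simp

lemma absval_add_le: "absval x \<le> B \<Longrightarrow> absval y \<le> B \<Longrightarrow> absval (x + y) \<le> B"
  using absval_add[of x y] by simp

lemma absval_diff_le: "absval x \<le> B \<Longrightarrow> absval y \<le> B \<Longrightarrow> absval (x - y) \<le> B"
  using absval_diff[of x y] by simp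

lemma absval_add_less: "absval x < B \<Longrightarrow> absval y < B \<Longrightarrow> absval (x + y) < B"
  using absval_add[of x y] by simp

text \<open>Writing x as \<open>(x + y) - y\<close> bounds \<open>absval x\<close> back by
  \<open>absval (x + y)\<close>, because y is too small to be the maximum. This is how a single
  dominant term is detected throughout.\<close>

lemma absval_add_eq:
  assumes "absval y < absval x" shows "absval (x + y) = absval x"
proof -
  have "absval (x + y) \<le> absval x" using absval_add[of x y] assms by simp
  moreover have "absval x \<le> max (absval (x + y)) (absval y)"
    using absval_diff[of "x + y" y] by simp
  ultimately show ?thesis using assms by auto
qed

lemma absval_power: "absval (x ^ n) = absval x ^ n"
  by (induction n) (auto simp: absval_mult)

lemma absval_inverse: "absval (inverse x) = inverse (absval x)"
proof (cases "x = 0")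
  case False
  then have "absval x * absval (inverse x) = 1" by (simp flip: absval_mult)
  then show ?thesis using False by (simp add: field_simps inverse_eq_divide)
qed auto

lemma absval_divide: "absval (x / y) = absval x / absval y"
  by (simp add: divide_inverse absval_mult absval_inverse)

lemma absval_sum_le:
  assumes "\<And>i. i \<in> A \<Longrightarrow> absval (f i) \<le> B" "0 \<le> B"
  shows "absval (sum f A) \<le> B"
  using assms(1) by (induction A rule: infinite_finite_induct) (auto simp: assms(2) intro: absval_add_le)

lemma absval_sum_less:
  assumes "\<And>i. i \<in> A \<Longrightarrow> absval (f i) < B" "0 < B"
  shows "absval (sum f A) < B"
  using assms(1) by (induction A rule: infinite_finite_induct) (auto simp: assms(2) intro: absval_add_less)

lemma absval_of_nat: "absval (of_nat n) \<le> 1"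
  by (induction n) (auto intro: absval_add_le)

text \<open>The class fixes the metric but no continuity of the operations. With this instance the
  general facts on limits of sums and differences apply; products are handled through
  \<open>absval_mult\<close>.\<close>

instance nonarch_complete_field \<subseteq> topological_ab_group_add
proof
  fix a b :: 'a
  show "((\<lambda>x. fst x + snd x) \<longlongrightarrow> a + b) (nhds a \<times>\<^sub>F nhds b)"
  proof (rule tendstoI)
    fix e :: real assume "0 < e"
    then have "\<forall>\<^sub>F x in nhds a. dist x a < e" "\<forall>\<^sub>F x in nhds b. dist x b < e"
      by (auto simp: eventually_nhds_metric)
    moreover have "dist (x + y) (a + b) < e" if "dist x a < e" "dist y b < e" for x y :: 'a
    proof -
      have "x + y - (a + b) = (x - a) + (y - b)" by simp
      then show ?thesis using that absval_add_less[of "x - a" e "y - b"] by (simp only: dist_absval)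
    qed
    ultimately show "\<forall>\<^sub>F x in nhds a \<times>\<^sub>F nhds b. dist (fst x + snd x) (a + b) < e"
      unfolding eventually_prod_filter by fastforce
  qed
  show "(uminus \<longlongrightarrow> - a) (nhds a)"
  proof (rule tendstoI)
    fix e :: real assume "0 < e"
    have "dist (- x) (- a) = dist x a" for x :: 'a
      by (simp add: dist_absval absval_minus_commute)
    then show "\<forall>\<^sub>F x in nhds a. dist (- x) (- a) < e"
      using \<open>0 < e\<close> by (auto simp: eventually_nhds_metric)
  qed
qed

section \<open>Sequences and series under an ultrametric\<close>

lemma LIMSEQ_0_le:
  fixes f g :: "nat \<Rightarrow> real"
  assumes "g \<longlonglongrightarrow> 0" "\<And>n. 0 \<le> f n" "\<forall>\<^sub>F n in sequentially. f n \<le> g n"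
  shows "f \<longlonglongrightarrow> 0"
  by (rule real_tendsto_sandwich[OF _ assms(3) tendsto_const assms(1)]) (simp add: assms(2))

lemma tendsto_absval_iff:
  fixes f :: "nat \<Rightarrow> 'a::nonarch_complete_field"
  shows "f \<longlonglongrightarrow> l \<longleftrightarrow> (\<lambda>n. absval (f n - l)) \<longlonglongrightarrow> 0"
  by (simp add: tendsto_dist_iff[of f] dist_absval)

text \<open>By the ultrametric inequality a telescoping sum is no larger than its largest step, so
  consecutive differences alone decide the Cauchy property.\<close>

lemma Cauchy_absval_diff:
  fixes x :: "nat \<Rightarrow> 'a::nonarch_complete_field"
  assumes "(\<lambda>n. absval (x (Suc n) - x n)) \<longlonglongrightarrow> 0"
  shows "Cauchy x"
proof (rule metric_CauchyI)
  fix e :: real assume e: "0 < e"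
  obtain N where N: "absval (x (Suc n) - x n) < e" if "n \<ge> N" for n
    using LIMSEQ_D[OF assms e] by auto
  have *: "absval (x n - x N) < e" if "n \<ge> N" for n
    using that
  proof (induction n rule: dec_induct)
    case (step n)
    have "x (Suc n) - x N = (x (Suc n) - x n) + (x n - x N)" by simp
    then show ?case using step N absval_add_less[of "x (Suc n) - x n" e "x n - x N"] by auto
  qed (use e in auto)
  show "\<exists>M. \<forall>m\<ge>M. \<forall>n\<ge>M. dist (x m) (x n) < e"
  proof (intro exI allI impI)
    fix m n assume "N \<le> m" "N \<le> n"
    have "x m - x n = (x m - x N) + (x N - x n)" by simp
    then show "dist (x m) (x n) < e"
      using *[OF \<open>N \<le> m\<close>] *[OF \<open>N \<le> n\<close>] absval_add_less[of "x m - x N" e "x N - x n"]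
      by (simp add: dist_absval absval_minus_commute)
  qed
qed

lemma summable_absval:
  fixes f :: "nat \<Rightarrow> 'a::nonarch_complete_field"
  assumes "(\<lambda>n. absval (f n)) \<longlonglongrightarrow> 0"
  shows "summable f"
proof -
  have "Cauchy (\<lambda>n. \<Sum>i<n. f i)"
    by (rule Cauchy_absval_diff) (use assms in simp)
  then show ?thesis by (simp add: summable_iff_convergent Cauchy_convergent_iff)
qed

lemma summable_absval_LIMSEQ:
  fixes f :: "nat \<Rightarrow> 'a::nonarch_complete_field"
  assumes "summable f"
  shows "(\<lambda>n. absval (f n)) \<longlonglongrightarrow> 0"
proof -
  obtain l where l: "(\<lambda>n. \<Sum>i<n. f i) \<longlonglongrightarrow> l"
    using assms by (auto simp: summable_def sums_def)
  have "(\<lambda>n. (\<Sum>i<Suc n. f i) - (\<Sum>i<n. f i)) \<longlonglongrightarrow> l - l"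
    by (intro tendsto_diff LIMSEQ_Suc[OF l] l)
  then show ?thesis by (simp add: tendsto_absval_iff)
qed

lemma absval_limit_le:
  fixes x :: "nat \<Rightarrow> 'a::nonarch_complete_field"
  assumes "x \<longlonglongrightarrow> l" "\<And>n. n \<ge> N \<Longrightarrow> absval (x n) \<le> B"
  shows "absval l \<le> B"
proof -
  have "(\<lambda>n. dist (x n) 0) \<longlonglongrightarrow> dist l 0"
    by (intro tendsto_intros assms)
  then have "dist l 0 \<le> B"
    by (rule Lim_bounded[where M=N]) (use assms(2) in \<open>auto simp: dist_absval\<close>)
  then show ?thesis by (simp add: dist_absval)
qed

section \<open>Entire functions\<close>

text \<open>Powers of the element and of its inverse have arbitrarily small and arbitrarily large
  absolute values, which lets field elements stand in for real radii.\<close>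

locale nontrivial_nonarch_field =
  fixes K :: "'a::nonarch_complete_field itself"
  assumes nontrivial: "\<exists>\<pi>::'a. 0 < absval \<pi> \<and> absval \<pi> < 1"
begin

lemma ex_absval_ge: "\<exists>z::'a. R \<le> absval z"
proof -
  obtain \<pi> :: 'a where \<pi>: "0 < absval \<pi>" "absval \<pi> < 1" using nontrivial by blast
  then have "1 < inverse (absval \<pi>)" by (rule one_less_inverse)
  then obtain n where "R < inverse (absval \<pi>) ^ n" using real_arch_pow by blast
  then show ?thesis by (intro exI[of _ "inverse \<pi> ^ n"]) (simp add: absval_power absval_inverse)
qed

lemma ex_absval_small:
  assumes "0 < e" shows "\<exists>z::'a. z \<noteq> 0 \<and> absval z < e"
proof -
  obtain z :: 'a where "inverse e + 1 \<le> absval z" using ex_absval_ge by blast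
  then have "inverse e < absval z" by simp
  then have "inverse (absval z) < e"
    using less_imp_inverse_less[of "inverse e" "absval z"] assms by simp
  moreover have "z \<noteq> 0" using \<open>inverse e < absval z\<close> assms by auto
  ultimately show ?thesis by (intro exI[of _ "inverse z"]) (simp add: absval_inverse)
qed

text \<open>Bounds for every real radius are easier to propagate through ring operations than
  convergence at every point. They suffice for convergence, because passing to a smaller radius
  gains a geometric factor.\<close>

lemma entire_iff:
  fixes f :: "'a fps"
  shows "f \<in> entire \<longleftrightarrow> (\<forall>R>0. \<exists>B. \<forall>n. absval (f $ n) * R ^ n \<le> B)"
proof (intro iffI allI impI)
  fix R :: real assume f: "f \<in> entire" and R: "0 < R"
  obtain z :: 'a where z: "R \<le> absval z" using ex_absval_ge by blast
  have "summable (\<lambda>n. f $ n * z ^ n)" using f by (simp add: entire_def)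
  then have "convergent (\<lambda>n. absval (f $ n * z ^ n))"
    using summable_absval_LIMSEQ convergentI by blast
  then obtain B where B: "\<And>n. absval (f $ n * z ^ n) \<le> B"
    using convergent_imp_Bseq by (force simp: Bseq_def)
  have "absval (f $ n) * R ^ n \<le> B" for n
  proof -
    have "absval (f $ n) * R ^ n \<le> absval (f $ n) * absval z ^ n"
      using R z by (intro mult_left_mono power_mono) auto
    also have "\<dots> \<le> B" using B[of n] by (simp add: absval_mult absval_power)
    finally show ?thesis .
  qed
  then show "\<exists>B. \<forall>n. absval (f $ n) * R ^ n \<le> B" by blast
next
  assume *: "\<forall>R>0. \<exists>B. \<forall>n. absval (f $ n) * R ^ n \<le> B"
  show "f \<in> entire"
    unfolding entire_def
  proof (intro CollectI allI summable_absval)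
    fix z :: 'a
    define R where "R = 2 * (absval z + 1)"
    have R: "0 < R" using absval_nonneg[of z] by (simp add: R_def add_nonneg_pos)
    obtain B where B: "\<And>n. absval (f $ n) * R ^ n \<le> B" using * R by blast
    have q: "absval z / R < 1" "0 \<le> absval z / R"
      using absval_nonneg[of z] R by (auto simp: R_def field_simps simp del: absval_nonneg)
    have lim: "(\<lambda>n. B * (absval z / R) ^ n) \<longlonglongrightarrow> 0"
      using q by (intro tendsto_mult_right_zero LIMSEQ_power_zero) auto
    have le: "absval (f $ n * z ^ n) \<le> B * (absval z / R) ^ n" for n
    proof -
      have "absval (f $ n * z ^ n) = (absval (f $ n) * R ^ n) * (absval z / R) ^ n"
        using R by (simp add: absval_mult absval_power power_divide)
      also have "\<dots> \<le> B * (absval z / R) ^ n"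
        using q by (intro mult_right_mono B) auto
      finally show ?thesis .
    qed
    show "(\<lambda>n. absval (f $ n * z ^ n)) \<longlonglongrightarrow> 0"
      by (rule LIMSEQ_0_le[OF lim]) (simp_all add: le always_eventually)
  qed
qed

lemma entire_bound:
  fixes f :: "'a fps"
  assumes "f \<in> entire" "0 < R"
  shows "\<exists>B>0. \<forall>n. absval (f $ n) * R ^ n \<le> B"
proof -
  obtain B where B: "\<And>n. absval (f $ n) * R ^ n \<le> B" using assms entire_iff by blast
  show ?thesis by (rule exI[of _ "max B 1"]) (use B in \<open>auto simp: le_max_iff_disj\<close>)
qed

lemma entire_LIMSEQ:
  fixes f :: "'a fps"
  assumes f: "f \<in> entire" and R: "0 \<le> R"
  shows "(\<lambda>n. absval (f $ n) * R ^ n) \<longlonglongrightarrow> 0"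
proof -
  obtain z :: 'a where z: "R \<le> absval z" using ex_absval_ge by blast
  have lim: "(\<lambda>n. absval (f $ n * z ^ n)) \<longlonglongrightarrow> 0"
    using f by (intro summable_absval_LIMSEQ) (simp add: entire_def)
  have le: "absval (f $ n) * R ^ n \<le> absval (f $ n * z ^ n)" for n
    using R z by (auto simp: absval_mult absval_power intro!: mult_left_mono power_mono)
  show ?thesis
    by (rule LIMSEQ_0_le[OF lim]) (use R in \<open>simp_all add: le always_eventually\<close>)
qed

lemma entire_sums:
  fixes f :: "'a fps"
  shows "f \<in> entire \<Longrightarrow> (\<lambda>n. f $ n * z ^ n) sums entire_eval f z"
  by (simp add: entire_def entire_eval_def summable_sums)

lemma entire_eval_le:
  fixes f :: "'a fps"
  assumes f: "f \<in> entire" and z: "absval z \<le> R" and B: "\<And>n. absval (f $ n) * R ^ n \<le> B"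
  shows "absval (entire_eval f z) \<le> B"
proof (rule absval_limit_le[of "\<lambda>n. \<Sum>i<n. f $ i * z ^ i" _ 0])
  show "(\<lambda>n. \<Sum>i<n. f $ i * z ^ i) \<longlonglongrightarrow> entire_eval f z"
    using entire_sums[OF f] by (simp add: sums_def)
  fix n
  have R: "0 \<le> R" using z absval_nonneg[of z] by linarith
  have "0 \<le> absval (f $ 0) * R ^ 0" by simp
  also have "\<dots> \<le> B" by (rule B)
  finally have "0 \<le> B" .
  moreover have "absval (f $ i * z ^ i) \<le> B" for i
  proof -
    have "absval (f $ i * z ^ i) \<le> absval (f $ i) * R ^ i"
      using R z by (auto simp: absval_mult absval_power intro!: mult_left_mono power_mono)
    then show ?thesis using B[of i] by linarith
  qed
  ultimately show "absval (\<Sum>i<n. f $ i * z ^ i) \<le> B" by (intro absval_sum_le)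
qed

section \<open>The ring of entire power series\<close>

lemma entire_const [simp]: "fps_const (c::'a) \<in> entire"
  unfolding entire_iff by (intro allI impI exI[of _ "absval c"]) auto

lemma entire_0 [simp]: "(0::'a fps) \<in> entire" and entire_1 [simp]: "(1::'a fps) \<in> entire"
  using entire_const[of 0] entire_const[of 1] by simp_all

lemma entire_X [simp]: "(fps_X::'a fps) \<in> entire"
  unfolding entire_iff
proof (intro allI impI)
  fix R :: real assume "0 < R"
  then show "\<exists>B. \<forall>n. absval (fps_X $ n :: 'a) * R ^ n \<le> B"
    by (intro exI[of _ R]) (auto simp: fps_X_def)
qed

lemma entire_minus [simp]: "f \<in> entire \<Longrightarrow> - (f::'a fps) \<in> entire"
  by (simp add: entire_iff)

lemma entire_add [simp]:
  fixes f g :: "'a fps"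
  assumes "f \<in> entire" "g \<in> entire" shows "f + g \<in> entire"
  unfolding entire_iff
proof (intro allI impI)
  fix R :: real assume R: "0 < R"
  obtain B1 where B1: "0 < B1" "\<And>n. absval (f $ n) * R ^ n \<le> B1" using entire_bound[OF assms(1) R] by blast
  obtain B2 where B2: "0 < B2" "\<And>n. absval (g $ n) * R ^ n \<le> B2" using entire_bound[OF assms(2) R] by blast
  have "absval ((f + g) $ n) * R ^ n \<le> max B1 B2" for n
  proof -
    have "absval (f $ n + g $ n) \<le> max B1 B2 / R ^ n"
      using B1(2)[of n] B2(2)[of n] R by (intro absval_add_le) (auto simp: field_simps)
    then show ?thesis using R by (simp add: field_simps)
  qed
  then show "\<exists>B. \<forall>n. absval ((f + g) $ n) * R ^ n \<le> B" by blast
qed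

lemma entire_diff [simp]:
  fixes f g :: "'a fps"
  shows "f \<in> entire \<Longrightarrow> g \<in> entire \<Longrightarrow> f - g \<in> entire"
  using entire_add[of f "- g"] by simp

lemma entire_mult [simp]:
  fixes f g :: "'a fps"
  assumes "f \<in> entire" "g \<in> entire" shows "f * g \<in> entire"
  unfolding entire_iff
proof (intro allI impI)
  fix R :: real assume R: "0 < R"
  obtain B1 where B1: "0 < B1" "\<And>n. absval (f $ n) * R ^ n \<le> B1" using entire_bound[OF assms(1) R] by blast
  obtain B2 where B2: "0 < B2" "\<And>n. absval (g $ n) * R ^ n \<le> B2" using entire_bound[OF assms(2) R] by blast
  have "absval ((f * g) $ n) * R ^ n \<le> B1 * B2" for n
  proof -
    have "absval (\<Sum>i=0..n. f $ i * g $ (n - i)) \<le> B1 * B2 / R ^ n"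
    proof (rule absval_sum_le)
      fix i assume "i \<in> {0..n}"
      then have "R ^ n = R ^ i * R ^ (n - i)" by (simp flip: power_add)
      then have "absval (f $ i * g $ (n - i)) * R ^ n = (absval (f $ i) * R ^ i) * (absval (g $ (n - i)) * R ^ (n - i))"
        by (simp only: absval_mult mult_ac)
      also have "\<dots> \<le> B1 * B2" using B1(1) R by (intro mult_mono B1 B2) auto
      finally show "absval (f $ i * g $ (n - i)) \<le> B1 * B2 / R ^ n" using R by (simp add: pos_le_divide_eq)
    qed (use B1(1) B2(1) R in auto)
    then show ?thesis using R by (simp add: pos_le_divide_eq fps_mult_nth)
  qed
  then show "\<exists>B. \<forall>n. absval ((f * g) $ n) * R ^ n \<le> B" by blast
qed

lemma entire_power [simp]: "f \<in> entire \<Longrightarrow> (f::'a fps) ^ n \<in> entire"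
  by (induction n) auto

lemma entire_of_poly [simp]: "fps_of_poly (p::'a poly) \<in> entire"
  by (induction p) (auto simp: fps_of_poly_pCons)

text \<open>The integer factors have absolute value at most 1, so only the index shift costs a
  factor 1 / R.\<close>

lemma entire_deriv [simp]:
  fixes f :: "'a fps"
  assumes "f \<in> entire" shows "fps_deriv f \<in> entire"
  unfolding entire_iff
proof (intro allI impI)
  fix R :: real assume R: "0 < R"
  obtain B where B: "0 < B" "\<And>n. absval (f $ n) * R ^ n \<le> B" using entire_bound[OF assms R] by blast
  have "absval (fps_deriv f $ n) * R ^ n \<le> B / R" for n
  proof -
    have "absval (fps_deriv f $ n) = absval (of_nat (Suc n) :: 'a) * absval (f $ Suc n)"
      by (simp add: absval_mult del: of_nat_Suc)
    also have "\<dots> \<le> absval (f $ Suc n)"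
      using mult_right_mono[OF absval_of_nat[of "Suc n"], of "absval (f $ Suc n)"] by simp
    finally have "absval (fps_deriv f $ n) * R ^ n \<le> absval (f $ Suc n) * R ^ n"
      using R by (intro mult_right_mono) auto
    also have "\<dots> \<le> B / R" using B(2)[of "Suc n"] R by (simp add: field_simps)
    finally show ?thesis .
  qed
  then show "\<exists>B. \<forall>n. absval (fps_deriv f $ n) * R ^ n \<le> B" by blast
qed

section \<open>Division by a linear factor and evaluation\<close>

lemma linear_factor_nth:
  fixes G :: "'a fps"
  shows "((fps_X - fps_const z) * G) $ 0 = - (z * G $ 0)"
    and "((fps_X - fps_const z) * G) $ Suc n = G $ n - z * G $ Suc n"
  by (simp_all add: left_diff_distrib)

text \<open>The partial sums of f at z telescope to w minus a multiple of the last coefficient of G,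
  which tends to 0. With \<open>entire_factor\<close> this identifies a value with the remainder of
  a division, so that rules for values become algebra.\<close>

lemma entire_eval_unique:
  fixes f :: "'a fps"
  assumes G: "G \<in> entire" and f: "f = fps_const w + (fps_X - fps_const z) * G"
  shows "entire_eval f z = w"
proof -
  have f0: "f $ 0 = w - z * G $ 0" and fS: "f $ Suc n = G $ n - z * G $ Suc n" for n
    unfolding f by (simp_all add: linear_factor_nth)
  have "(\<Sum>i<Suc n. f $ i * z ^ i) = w - G $ n * z ^ Suc n" for n
    by (induction n) (simp_all add: f0 fS algebra_simps)
  moreover have "(\<lambda>n. w - G $ n * z ^ Suc n) \<longlonglongrightarrow> w - 0"
  proof (intro tendsto_diff tendsto_const)
    have "(\<lambda>n. absval z * (absval (G $ n) * absval z ^ n)) \<longlonglongrightarrow> absval z * 0"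
      by (intro tendsto_mult tendsto_const entire_LIMSEQ G) auto
    then show "(\<lambda>n. G $ n * z ^ Suc n) \<longlonglongrightarrow> 0"
      by (simp add: tendsto_absval_iff absval_mult absval_power mult_ac)
  qed
  ultimately have "(\<lambda>n. \<Sum>i<Suc n. f $ i * z ^ i) \<longlonglongrightarrow> w" by simp
  then have "(\<lambda>n. f $ n * z ^ n) sums w" unfolding sums_def by (rule LIMSEQ_imp_Suc)
  then show ?thesis by (simp add: entire_eval_def sums_iff)
qed

lemma entire_factor:
  fixes f :: "'a fps"
  assumes f: "f \<in> entire"
  obtains G where "G \<in> entire" "f = fps_const (entire_eval f z) + (fps_X - fps_const z) * G"
proof (cases "z = 0")
  case True
  have "entire_eval f 0 = f $ 0"
  proof -
    have "(\<lambda>n. f $ n * 0 ^ n) sums (f $ 0)" using sums_single[of 0 "\<lambda>n. f $ n"] 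
      by (rule back_subst[where P="\<lambda>g. g sums (f $ 0)"]) auto
    then show ?thesis by (simp add: entire_eval_def sums_iff)
  qed
  moreover have "f = fps_const (f $ 0) + fps_X * fps_shift 1 f"
    by (auto simp: fps_eq_iff)
  moreover have "fps_shift 1 f \<in> entire"
    unfolding entire_iff
  proof (intro allI impI)
    fix R :: real assume R: "0 < R"
    obtain B where B: "0 < B" "\<And>n. absval (f $ n) * R ^ n \<le> B" using entire_bound[OF f R] by blast
    show "\<exists>B. \<forall>n. absval (fps_shift 1 f $ n) * R ^ n \<le> B"
      using B(2)[of "Suc _"] R by (intro exI[of _ "B / R"]) (auto simp: field_simps)
  qed
  ultimately show ?thesis using that[of "fps_shift 1 f"] True by simp
next
  case False
  define S where "S n = (\<Sum>i<n. f $ i * z ^ i)" for n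
  \<comment> \<open>Solving the recursion for the coefficients of the quotient gives the tail of the
    series at z beyond index n, divided by \<open>z ^ Suc n\<close>. In this form their growth can
    be estimated.\<close>
  define G where "G = Abs_fps (\<lambda>n. (entire_eval f z - S (Suc n)) / z ^ Suc n)"
  have eq: "f = fps_const (entire_eval f z) + (fps_X - fps_const z) * G"
  proof (rule fps_ext)
    fix n show "f $ n = (fps_const (entire_eval f z) + (fps_X - fps_const z) * G) $ n"
    proof (cases n)
      case 0 then show ?thesis using False by (simp add: linear_factor_nth G_def S_def)
    next
      case (Suc m)
      have "G $ m - z * G $ Suc m = (S (Suc (Suc m)) - S (Suc m)) / z ^ Suc m"
        using False by (simp add: G_def field_simps)
      also have "\<dots> = f $ Suc m" using False by (simp add: S_def)
      finally show ?thesis using Suc by (simp add: linear_factor_nth)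
    qed
  qed
  have "G \<in> entire"
    unfolding entire_iff
  proof (intro allI impI)
    fix R' :: real assume R': "0 < R'"
    \<comment> \<open>The tail at z is estimated on a disc that contains z, hence the enlarged
      radius.\<close>
    define R where "R = max R' (absval z)"
    have R: "0 < R" "R' \<le> R" "absval z \<le> R" using R' by (auto simp: R_def)
    obtain B where B: "0 < B" "\<And>n. absval (f $ n) * R ^ n \<le> B" using entire_bound[OF f R(1)] by blast
    have "absval (G $ n) * R' ^ n \<le> B / R" for n
    proof -
      have tail: "absval (entire_eval f z - S (Suc n)) \<le> B * (absval z / R) ^ Suc n"
      proof (rule absval_limit_le[of "\<lambda>m. S m - S (Suc n)" _ "Suc n"])
        show "(\<lambda>m. S m - S (Suc n)) \<longlonglongrightarrow> entire_eval f z - S (Suc n)"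
          using entire_sums[OF f, of z] by (intro tendsto_intros) (simp add: sums_def S_def)
        fix m assume "Suc n \<le> m"
        have "S m - S (Suc n) = (\<Sum>i=Suc n..<m. f $ i * z ^ i)"
          unfolding S_def using \<open>Suc n \<le> m\<close>
          by (metis lessThan_atLeast0 sum_diff_nat_ivl zero_le)
        moreover have "absval (\<Sum>i=Suc n..<m. f $ i * z ^ i) \<le> B * (absval z / R) ^ Suc n"
        proof (rule absval_sum_le)
          fix i assume i: "i \<in> {Suc n..<m}"
          have "absval (f $ i * z ^ i) = (absval (f $ i) * R ^ i) * (absval z / R) ^ i"
            using R by (simp add: absval_mult absval_power power_divide)
          also have "\<dots> \<le> B * (absval z / R) ^ i" using R by (intro mult_right_mono B) auto
          also have "\<dots> \<le> B * (absval z / R) ^ Suc n"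
            using R B i by (intro mult_left_mono power_decreasing) auto
          finally show "absval (f $ i * z ^ i) \<le> B * (absval z / R) ^ Suc n" .
        qed (use R B in auto)
        ultimately show "absval (S m - S (Suc n)) \<le> B * (absval z / R) ^ Suc n" by simp
      qed
      have "absval (G $ n) = absval (entire_eval f z - S (Suc n)) / absval z ^ Suc n"
        by (simp add: G_def absval_divide absval_power absval_mult)
      also have "\<dots> \<le> B * (absval z / R) ^ Suc n / absval z ^ Suc n"
        by (intro divide_right_mono tail) auto
      also have "\<dots> = B / R ^ Suc n" using False by (simp add: power_divide)
      finally have "absval (G $ n) * R ^ n \<le> B / R" using R by (simp add: field_simps)
      moreover have "absval (G $ n) * R' ^ n \<le> absval (G $ n) * R ^ n"
        using R R' by (intro mult_left_mono power_mono) auto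
      ultimately show ?thesis by linarith
    qed
    then show "\<exists>B. \<forall>n. absval (G $ n) * R' ^ n \<le> B" by blast
  qed
  then show ?thesis using that eq by blast
qed

lemma entire_eval_const [simp]: "entire_eval (fps_const c) z = (c::'a)"
  by (rule entire_eval_unique[of 0]) auto

lemma entire_eval_0 [simp]: "entire_eval 0 z = (0::'a)"
  and entire_eval_1 [simp]: "entire_eval 1 z = (1::'a)"
  using entire_eval_const[of 0 z] entire_eval_const[of 1 z] by (simp_all del: entire_eval_const)

lemma entire_eval_X [simp]: "entire_eval fps_X z = (z::'a)"
  by (rule entire_eval_unique[of 1]) auto

lemma entire_eval_add [simp]:
  fixes f g :: "'a fps"
  assumes "f \<in> entire" "g \<in> entire"
  shows "entire_eval (f + g) z = entire_eval f z + entire_eval g z"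
  using sums_add[OF entire_sums[OF assms(1), of z] entire_sums[OF assms(2), of z]]
    entire_sums[OF entire_add[OF assms], of z]
  by (metis (no_types, lifting) fps_add_nth distrib_right sums_cong sums_unique2)

text \<open>Divide both factors with remainder by \<open>fps_X - fps_const z\<close>: the product of
  the remainders is the remainder of the product, and no Cauchy product has to be summed.\<close>

lemma entire_eval_mult [simp]:
  fixes f g :: "'a fps"
  assumes "f \<in> entire" "g \<in> entire"
  shows "entire_eval (f * g) z = entire_eval f z * entire_eval g z"
proof -
  define \<alpha> \<beta> where "\<alpha> = entire_eval f z" and "\<beta> = entire_eval g z"
  obtain F G where F: "F \<in> entire" "f = fps_const \<alpha> + (fps_X - fps_const z) * F"
    and G: "G \<in> entire" "g = fps_const \<beta> + (fps_X - fps_const z) * G"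
    using entire_factor[OF assms(1)] entire_factor[OF assms(2)] \<alpha>_def \<beta>_def by metis
  have "f * g = fps_const (\<alpha> * \<beta>) + (fps_X - fps_const z) * (fps_const \<alpha> * G + F * g)"
    unfolding F(2) G(2) fps_const_mult[symmetric] by (simp only: algebra_simps)
  moreover have "fps_const \<alpha> * G + F * g \<in> entire" using F G assms by auto
  ultimately show ?thesis using entire_eval_unique \<alpha>_def \<beta>_def by blast
qed

lemma entire_eval_minus [simp]:
  fixes f :: "'a fps"
  assumes "f \<in> entire"
  shows "entire_eval (- f) z = - entire_eval f z"
  using entire_eval_add[OF assms entire_minus[OF assms], of z] by (simp add: add_eq_0_iff)

lemma entire_eval_diff [simp]:
  fixes f g :: "'a fps"
  assumes "f \<in> entire" "g \<in> entire"
  shows "entire_eval (f - g) z = entire_eval f z - entire_eval g z"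
  using entire_eval_add[OF assms(1) entire_minus[OF assms(2)], of z] assms by simp

lemma entire_eval_power [simp]:
  fixes f :: "'a fps"
  shows "f \<in> entire \<Longrightarrow> entire_eval (f ^ n) z = entire_eval f z ^ n"
  by (induction n) auto

lemma entire_eval_of_poly [simp]: "entire_eval (fps_of_poly (p::'a poly)) z = poly p z"
  by (induction p) (auto simp: fps_of_poly_pCons)

lemma entire_zero_factor:
  fixes f :: "'a fps"
  assumes "f \<in> entire" "entire_eval f z = 0"
  obtains G where "G \<in> entire" "f = (fps_X - fps_const z) * G"
  using entire_factor[OF assms(1), of z] assms(2) by auto

text \<open>The quotient of \<open>f - f(a)\<close> by the linear factor at a is bounded near a, so
  the difference of values is at most a constant times the distance.\<close>

lemma entire_continuous:
  fixes f :: "'a fps" and x :: "nat \<Rightarrow> 'a"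
  assumes f: "f \<in> entire" and x: "x \<longlonglongrightarrow> a"
  shows "(\<lambda>n. entire_eval f (x n)) \<longlonglongrightarrow> entire_eval f a"
proof -
  obtain G where G: "G \<in> entire" "f = fps_const (entire_eval f a) + (fps_X - fps_const a) * G"
    using entire_factor[OF f] by blast
  define R where "R = max 1 (absval a)"
  have R: "0 < R" "1 \<le> R" "absval a \<le> R" by (auto simp: R_def)
  obtain B where B: "0 < B" "\<And>n. absval (G $ n) * R ^ n \<le> B" using entire_bound[OF G(1) R(1)] by blast
  have lim: "(\<lambda>n. absval (x n - a)) \<longlonglongrightarrow> 0" using x by (simp add: tendsto_absval_iff)
  have "\<forall>\<^sub>F n in sequentially. absval (x n - a) < 1"
    using order_tendstoD(2)[OF lim, of 1] by simp
  then have "\<forall>\<^sub>F n in sequentially. absval (entire_eval f (x n) - entire_eval f a) \<le> absval (x n - a) * B"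
  proof eventually_elim
    case (elim n)
    then have "absval ((x n - a) + a) \<le> R" using R by (intro absval_add_le) auto
    then have "absval (entire_eval G (x n)) \<le> B" using entire_eval_le[OF G(1) _ B(2)] by simp
    moreover have "entire_eval f (x n) - entire_eval f a = (x n - a) * entire_eval G (x n)"
      using arg_cong[OF G(2), of "\<lambda>f. entire_eval f (x n)"] G(1) by simp
    ultimately show ?case by (simp add: absval_mult mult_left_mono)
  qed
  then have "(\<lambda>n. absval (entire_eval f (x n) - entire_eval f a)) \<longlonglongrightarrow> 0"
    by (rule LIMSEQ_0_le[OF tendsto_mult_left_zero[OF lim], rotated]) simp
  then show ?thesis by (simp add: tendsto_absval_iff)
qed

text \<open>The Weierstrass degree \<open>\<nu>\<close> is the number of zeros of \<open>f\<close> in the disc of radius \<open>R\<close>.\<close>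

definition wdegree :: "'a fps \<Rightarrow> real \<Rightarrow> nat \<Rightarrow> bool" where
  "wdegree f R \<nu> \<longleftrightarrow> f $ \<nu> \<noteq> 0 \<and> (\<forall>n. absval (f $ n) * R ^ n \<le> absval (f $ \<nu>) * R ^ \<nu>) \<and>
     (\<forall>n>\<nu>. absval (f $ n) * R ^ n < absval (f $ \<nu>) * R ^ \<nu>)"

text \<open>The terms tend to 0, so only finitely many are at least as large as one fixed nonzero
  term, and all maximal terms are among these.\<close>

lemma ex_wdegree:
  assumes f: "f \<in> entire" "f \<noteq> 0" and R: "0 < R"
  obtains \<nu> where "wdegree f R \<nu>"
proof -
  let ?v = "\<lambda>n. absval (f $ n) * R ^ n"
  obtain m where m: "f $ m \<noteq> 0" using f(2) by (auto simp: fps_eq_iff)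
  define A where "A = {n. ?v m \<le> ?v n}"
  have pos: "0 < ?v m" using m R by simp
  have "\<forall>\<^sub>F n in sequentially. ?v n < ?v m"
    using order_tendstoD(2)[OF entire_LIMSEQ[OF f(1)], of R "?v m"] pos R by simp
  then obtain N where "\<And>n. N \<le> n \<Longrightarrow> ?v n < ?v m" by (auto simp: eventually_sequentially)
  then have "A \<subseteq> {..<N}" unfolding A_def by (force simp: not_le[symmetric])
  then have finA: "finite A" by (rule finite_subset) simp
  have mA: "m \<in> A" by (simp add: A_def)
  define M where "M = Max (?v ` A)"
  have M: "M \<in> ?v ` A" unfolding M_def using finA mA by (intro Max_in) auto
  define D where "D = {n \<in> A. ?v n = M}"
  have D: "finite D" "D \<noteq> {}" using finA M by (auto simp: D_def)
  define \<nu> where "\<nu> = Max D"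
  have \<nu>: "\<nu> \<in> D" unfolding \<nu>_def using D by (rule Max_in)
  have le: "?v n \<le> M" for n
  proof (cases "n \<in> A")
    case True then show ?thesis unfolding M_def using finA by (intro Max_ge) auto
  next
    case False
    then have "?v n < ?v m" by (simp add: A_def)
    also have "\<dots> \<le> M" unfolding M_def using finA mA by (intro Max_ge) auto
    finally show ?thesis by simp
  qed
  have less: "?v n < M" if "\<nu> < n" for n
  proof (rule ccontr)
    assume "\<not> ?v n < M"
    with le[of n] have "?v n = M" by simp
    moreover have "?v m \<le> M" by (rule le)
    ultimately have "n \<in> D" by (simp add: D_def A_def)
    then have "n \<le> \<nu>" unfolding \<nu>_def using D by (intro Max_ge) auto
    with that show False by simp
  qed
  have "?v \<nu> = M" using \<nu> by (simp add: D_def)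
  moreover have "f $ \<nu> \<noteq> 0" using le[of m] pos \<open>?v \<nu> = M\<close> by auto
  ultimately show ?thesis using that[of \<nu>] le less by (simp add: wdegree_def)
qed

text \<open>The recursion \<open>G $ n = f $ Suc n + z * G $ Suc n\<close> is run downwards from an
  index where G is small. Down to index \<nu> it preserves strict smallness; at \<nu> - 1 the term
  \<open>f $ \<nu>\<close> dominates and forces equality; below that only the weak inequality
  survives. This drives the inductions that remove zeros.\<close>

lemma wdegree_factor:
  assumes wd: "wdegree f R \<nu>" and R: "0 < R" and z: "absval z \<le> R"
    and G: "G \<in> entire" and f: "f = (fps_X - fps_const z) * G"
  shows "0 < \<nu>" "wdegree G R (\<nu> - 1)"
proof -
  define M where "M = absval (f $ \<nu>) * R ^ \<nu>"
  have M: "0 < M" using wd R by (simp add: M_def wdegree_def)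
  have f0: "f $ 0 = - (z * G $ 0)" and fS: "f $ Suc n = G $ n - z * G $ Suc n" for n
    unfolding f by (simp_all add: linear_factor_nth)
  \<comment> \<open>The extra power of R aligns the n-th coefficient of G with the coefficient of f
    of index n + 1.\<close>
  let ?w = "\<lambda>n. absval (G $ n) * R ^ Suc n"
  have rec: "G $ n = f $ Suc n + z * G $ Suc n" for n by (simp add: fS)
  have zG: "absval (z * G $ n) * R ^ n \<le> ?w n" for n
    using z R by (simp add: absval_mult mult_ac mult_right_mono)
  have "(\<lambda>n. R * (absval (G $ n) * R ^ n)) \<longlonglongrightarrow> R * 0"
    using R by (intro tendsto_intros entire_LIMSEQ G) auto
  then have "\<forall>\<^sub>F n in sequentially. ?w n < M"
    using order_tendstoD(2)[of ?w 0 sequentially M] M by (simp add: mult_ac)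
  then obtain N where N: "\<And>n. N \<le> n \<Longrightarrow> ?w n < M" by (auto simp: eventually_sequentially)
  have less: "?w n < M" if "\<nu> \<le> n" for n
  proof -
    have "?w n < M" if "n \<le> max N n" "\<nu> \<le> n" for n
      using that
    proof (induction n rule: inc_induct[where j="max N n"])
      case base then show ?case using N by simp
    next
      case (step k)
      have 1: "absval (f $ Suc k) < M / R ^ Suc k"
        using wd step.prems R by (simp add: pos_less_divide_eq wdegree_def M_def del: power_Suc)
      have 2: "absval (z * G $ Suc k) < M / R ^ Suc k"
        using order.strict_trans1[OF zG[of "Suc k"] step.IH] step.prems R by (simp add: field_simps)
      have "absval (G $ k) < M / R ^ Suc k" unfolding rec[of k] by (rule absval_add_less[OF 1 2])
      then show ?case using R by (simp add: field_simps)
    qed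
    then show ?thesis using that by simp
  qed
  show pos: "0 < \<nu>"
  proof (rule ccontr)
    assume "\<not> 0 < \<nu>"
    then have "\<nu> = 0" by simp
    then have "M \<le> ?w 0" using zG[of 0] by (simp add: M_def f0)
    with less[of 0] \<open>\<nu> = 0\<close> show False by simp
  qed
  define \<mu> where "\<mu> = \<nu> - 1"
  have \<nu>: "\<nu> = Suc \<mu>" using pos by (simp add: \<mu>_def)
  have eq: "?w \<mu> = M"
  proof -
    have "absval (z * G $ \<nu>) * R ^ \<nu> < M" using zG[of \<nu>] less[of \<nu>] by simp
    then have "absval (z * G $ \<nu>) < absval (f $ \<nu>)" using R by (simp add: M_def)
    then have "absval (G $ \<mu>) = absval (f $ \<nu>)" using absval_add_eq rec[of \<mu>] \<nu> by metis
    then show ?thesis by (simp add: M_def \<nu>)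
  qed
  have le: "?w n \<le> M" for n
  proof (cases "\<mu> \<le> n")
    case True then show ?thesis using eq less[of n] \<nu> by (cases "n = \<mu>") auto
  next
    case False
    then have "n \<le> \<mu>" by simp
    then show ?thesis
    proof (induction n rule: inc_induct)
      case base then show ?case using eq by simp
    next
      case (step k)
      have 1: "absval (f $ Suc k) \<le> M / R ^ Suc k"
        using wd R by (simp add: pos_le_divide_eq wdegree_def M_def del: power_Suc)
      have 2: "absval (z * G $ Suc k) \<le> M / R ^ Suc k"
        using order.trans[OF zG[of "Suc k"] step.IH] R by (simp add: field_simps)
      have "absval (G $ k) \<le> M / R ^ Suc k" unfolding rec[of k] by (rule absval_add_le[OF 1 2])
      then show ?case using R by (simp add: field_simps)
    qed
  qed
  have w: "?w n = R * (absval (G $ n) * R ^ n)" for n by simp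
  have "wdegree G R \<mu>"
    unfolding wdegree_def
  proof (intro conjI allI impI)
    show "G $ \<mu> \<noteq> 0" using eq M by auto
    fix n
    show "absval (G $ n) * R ^ n \<le> absval (G $ \<mu>) * R ^ \<mu>"
      using le[of n] eq R unfolding w by (metis mult_le_cancel_left_pos)
    assume "\<mu> < n"
    then show "absval (G $ n) * R ^ n < absval (G $ \<mu>) * R ^ \<mu>"
      using less[of n] eq R \<nu> unfolding w by (metis Suc_leI mult_less_cancel_left_pos)
  qed
  then show "wdegree G R (\<nu> - 1)" by (simp add: \<mu>_def)
qed

lemma wdegree_0_no_zero:
  assumes "wdegree f R 0" "0 < R" "absval z \<le> R" "f \<in> entire"
  shows "entire_eval f z \<noteq> 0"
  using wdegree_factor(1)[OF assms(1-3)] entire_zero_factor[OF assms(4)] by (metis less_irrefl)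

section \<open>Finiteness and orders of zeros, and the identity principle\<close>

text \<open>Each zero that is divided out lowers the Weierstrass degree, and at degree 0 there is no
  zero left in the disc.\<close>

lemma finite_zeros_in_disc:
  assumes f: "f \<in> entire" "f \<noteq> 0"
  shows "finite {z::'a. absval z \<le> R \<and> entire_eval f z = 0}"
proof (cases "0 < R")
  case R: True
  obtain \<nu> where "wdegree f R \<nu>" using ex_wdegree[OF f R] by blast
  then show ?thesis using f
  proof (induction \<nu> arbitrary: f)
    case 0
    then show ?case using wdegree_0_no_zero[OF _ R] by (auto intro: finite_subset[of _ "{}"])
  next
    case (Suc \<nu>)
    show ?case
    proof (cases "\<exists>z. absval z \<le> R \<and> entire_eval f z = 0")
      case True
      then obtain z where z: "absval z \<le> R" "entire_eval f z = 0" by blast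
      obtain G where G: "G \<in> entire" "f = (fps_X - fps_const z) * G"
        using entire_zero_factor[OF Suc.prems(2) z(2)] by blast
      have "wdegree G R \<nu>" using wdegree_factor(2)[OF Suc.prems(1) R z(1) G] by simp
      moreover have "G \<noteq> 0" using G Suc.prems(3) by auto
      ultimately have "finite {z. absval z \<le> R \<and> entire_eval G z = 0}" using Suc.IH G by blast
      moreover have "{z. absval z \<le> R \<and> entire_eval f z = 0} \<subseteq> insert z {z. absval z \<le> R \<and> entire_eval G z = 0}"
        using G by auto
      ultimately show ?thesis by (meson finite_insert finite_subset)
    qed (auto intro: finite_subset[of _ "{}"])
  qed
next
  case False
  have "z \<in> {0}" if "absval z \<le> R" for z :: 'a
    using that False absval_nonneg[of z] absval_eq_0_iff[of z] by force
  then have "{z::'a. absval z \<le> R \<and> entire_eval f z = 0} \<subseteq> {0}" by blast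
  then show ?thesis by (rule finite_subset) simp
qed

text \<open>A finite disc would have a least nonzero absolute value, contrary to the existence of
  arbitrarily small elements. With the preceding lemma this yields the identity principle.\<close>

lemma infinite_disc:
  assumes "0 < R" shows "infinite {z::'a. absval z \<le> R}"
proof
  assume fin: "finite {z::'a. absval z \<le> R}"
  let ?A = "absval ` ({z::'a. absval z \<le> R} - {0})"
  obtain z0 :: 'a where "z0 \<noteq> 0" "absval z0 < R" using ex_absval_small[OF assms] by blast
  then have "z0 \<in> {z. absval z \<le> R} - {0}" by simp
  then have A: "finite ?A" "?A \<noteq> {}" using fin by blast+
  then have "Min ?A \<in> ?A" by (rule Min_in)
  then have "0 < Min ?A" by auto
  then obtain z :: 'a where z: "z \<noteq> 0" "absval z < Min ?A" "absval z < R"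
    using ex_absval_small[of "min (Min ?A) R"] assms by auto
  then have "Min ?A \<le> absval z" using A by (intro Min_le) auto
  with z show False by simp
qed

lemma entire_eq_0:
  assumes "f \<in> entire" "\<And>z::'a. entire_eval f z = 0" shows "f = 0"
  using finite_zeros_in_disc[OF assms(1), of 1] infinite_disc[of 1] assms(2) by auto

lemma entire_eqI:
  assumes "f \<in> entire" "g \<in> entire" "\<And>z::'a. entire_eval f z = entire_eval g z" shows "f = g"
  using entire_eq_0[of "f - g"] assms by simp

text \<open>Dividing out the linear factor at a must stop, since each division lowers the
  Weierstrass degree on a disc that contains a. Order 0 means that a is not a zero.\<close>

lemma ex_zero_of_order:
  fixes f :: "'a fps"
  assumes f: "f \<in> entire" "f \<noteq> 0"
  obtains k where "zero_of_order f a k"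
proof -
  define R where "R = max 1 (absval a)"
  have R: "0 < R" "absval a \<le> R" by (auto simp: R_def)
  obtain \<nu> where "wdegree f R \<nu>" using ex_wdegree[OF f R(1)] by blast
  then have "\<exists>k. zero_of_order f a k" using f
  proof (induction \<nu> arbitrary: f rule: less_induct)
    case (less \<nu>)
    show ?case
    proof (cases "entire_eval f a = 0")
      case True
      then obtain G where G: "G \<in> entire" "f = (fps_X - fps_const a) * G"
        using entire_zero_factor less.prems by blast
      have "0 < \<nu>" "wdegree G R (\<nu> - 1)" using wdegree_factor[OF less.prems(1) R G] by auto
      moreover have "G \<noteq> 0" using G less.prems by auto
      ultimately obtain k where "zero_of_order G a k" using less.IH[of "\<nu> - 1" G] G by auto
      then obtain g where "g \<in> entire" "G = (fps_X - fps_const a) ^ k * g" "entire_eval g a \<noteq> 0"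
        by (auto simp: zero_of_order_def)
      then have "zero_of_order f a (Suc k)"
        unfolding zero_of_order_def G(2) by (intro bexI[of _ g]) (auto simp: mult_ac)
      then show ?thesis by blast
    next
      case False
      then have "zero_of_order f a 0" using less.prems by (auto simp: zero_of_order_def)
      then show ?thesis by blast
    qed
  qed
  then show ?thesis using that by blast
qed

end

section \<open>Zeros over an algebraically closed field\<close>

locale nonarch_alg_closed = nontrivial_nonarch_field K
  for K :: "'a::nonarch_complete_field itself" +
  assumes alg_closed: "\<And>q::'a poly. 0 < degree q \<Longrightarrow> \<exists>x. poly q x = 0"
begin

section \<open>Polynomials: sizes of coefficients and location of roots\<close>

text \<open>For a root t with \<open>absval t\<close> at least r, the constant term of X - t
  dominates on the disc of radius r, and such dominance passes to products.\<close>

lemma coeff_le_of_roots_ge: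
  fixes P :: "'a poly"
  assumes "P \<noteq> 0" "0 \<le> r" "\<And>t. poly P t = 0 \<Longrightarrow> r \<le> absval t"
  shows "absval (coeff P n) * r ^ n \<le> absval (coeff P 0)"
  using assms(1,3)
proof (induction "degree P" arbitrary: P n rule: less_induct)
  case less
  show ?case
  proof (cases "degree P = 0")
    case True
    then obtain c where "P = [:c:]" using degree_0_id by metis
    then show ?thesis by (cases n) auto
  next
    case False
    then obtain t where t: "poly P t = 0" using alg_closed by blast
    then obtain Q where Q: "P = [:- t, 1:] * Q" using poly_eq_0_iff_dvd by (metis dvdE)
    have "Q \<noteq> 0" using Q less.prems by auto
    then have deg: "degree Q < degree P" unfolding Q by (subst degree_mult_eq) auto
    have IH: "absval (coeff Q m) * r ^ m \<le> absval (coeff Q 0)" for m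
      using less.hyps[OF deg \<open>Q \<noteq> 0\<close>] less.prems(2) Q by simp
    have rt: "r \<le> absval t" using less.prems(2) t by blast
    have P0: "coeff P 0 = - (t * coeff Q 0)" by (simp add: Q)
    show ?thesis
    proof (cases n)
      case (Suc m)
      have "coeff P n = coeff Q m - t * coeff Q n" by (simp add: Q Suc)
      moreover have "absval (coeff Q m) * r ^ n \<le> absval (coeff P 0)"
      proof -
        have "absval (coeff Q m) * r ^ n = r * (absval (coeff Q m) * r ^ m)" by (simp add: Suc)
        also have "\<dots> \<le> absval t * absval (coeff Q 0)" using IH rt assms(2) by (intro mult_mono) auto
        finally show ?thesis by (simp add: P0 absval_mult)
      qed
      moreover have "absval (t * coeff Q n) * r ^ n \<le> absval (coeff P 0)"
        using mult_left_mono[OF IH[of n], of "absval t"] by (simp add: P0 absval_mult mult_ac)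
      moreover have "absval (x - y) * r ^ n \<le> B"
        if "absval x * r ^ n \<le> B" "absval y * r ^ n \<le> B" for x y :: 'a and B
        using mult_right_mono[OF absval_diff[of x y], of "r ^ n"] that assms(2) by (auto simp: max_def split: if_splits)
      ultimately show ?thesis by simp
    qed simp
  qed
qed

text \<open>Take a root t of least absolute value and apply the preceding lemma with that value as
  r.\<close>

lemma ex_small_root:
  fixes P :: "'a poly"
  assumes "0 < n" "coeff P n \<noteq> 0"
  obtains t where "poly P t = 0" "absval (coeff P n) * absval t ^ n \<le> absval (coeff P 0)"
proof -
  have "n \<le> degree P" using assms(2) by (rule le_degree)
  then have "P \<noteq> 0" "0 < degree P" using assms by auto
  let ?A = "absval ` {t. poly P t = 0}"
  have fin: "finite ?A" using poly_roots_finite[OF \<open>P \<noteq> 0\<close>] by simp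
  have "?A \<noteq> {}" using alg_closed[OF \<open>0 < degree P\<close>] by auto
  then have "Min ?A \<in> ?A" by (rule Min_in[OF fin])
  then obtain t where t: "poly P t = 0" "absval t = Min ?A" by auto
  have "absval t \<le> absval s" if "poly P s = 0" for s
    unfolding t(2) using fin that by (intro Min_le) auto
  from coeff_le_of_roots_ge[OF \<open>P \<noteq> 0\<close> _ this] show ?thesis using t(1) that by simp
qed

text \<open>Moving the centre within the disc adds to the m-th coefficient only multiples of the
  higher ones. Binomial coefficients have absolute value at most 1, so by \<open>dom\<close> every
  added term is strictly smaller than the coefficient itself.\<close>

lemma absval_coeff_translate:
  fixes P :: "'a poly"
  assumes R: "0 < R" and x: "absval x \<le> R" and nz: "coeff P m \<noteq> 0"
    and dom: "\<And>n. m < n \<Longrightarrow> absval (coeff P n) * R ^ n < absval (coeff P m) * R ^ m"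
  shows "absval (coeff (pcompose P [:x, 1:]) m) = absval (coeff P m)"
proof -
  have md: "m \<le> degree P" using nz by (rule le_degree)
  have "pcompose P [:x, 1:] = (\<Sum>i\<le>degree P. smult (coeff P i) ([:x, 1:] ^ i))"
    by (simp add: pcompose_altdef poly_altdef coeff_map_poly degree_map_poly)
  then have "coeff (pcompose P [:x, 1:]) m = (\<Sum>i\<le>degree P. coeff P i * coeff ([:x, 1:] ^ i) m)"
    by (simp add: coeff_sum)
  also have "\<dots> = (\<Sum>i\<in>{m..degree P}. coeff P i * coeff ([:x, 1:] ^ i) m)"
  proof (rule sum.mono_neutral_right)
    show "\<forall>i\<in>{..degree P} - {m..degree P}. coeff P i * coeff ([:x, 1:] ^ i) m = 0"
      by (auto simp: coeff_eq_0 degree_linear_power not_le)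
  qed auto
  also have "\<dots> = (\<Sum>i\<in>{m..degree P}. coeff P i * (of_nat (i choose m) * x ^ (i - m)))"
    by (intro sum.cong) (auto simp: coeff_linear_poly_power)
  also have "\<dots> = coeff P m + (\<Sum>i\<in>{m<..degree P}. coeff P i * (of_nat (i choose m) * x ^ (i - m)))"
    using md by (simp add: sum.head)
  finally have eq: "coeff (pcompose P [:x, 1:]) m =
    coeff P m + (\<Sum>i\<in>{m<..degree P}. coeff P i * (of_nat (i choose m) * x ^ (i - m)))" .
  have "absval (\<Sum>i\<in>{m<..degree P}. coeff P i * (of_nat (i choose m) * x ^ (i - m))) < absval (coeff P m)"
  proof (rule absval_sum_less)
    fix i assume i: "i \<in> {m<..degree P}"
    then have "R ^ i = R ^ m * R ^ (i - m)" by (simp flip: power_add)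
    then have lt: "absval (coeff P i) * R ^ (i - m) < absval (coeff P m)"
      using dom[of i] i R by (simp add: mult_ac)
    have "absval (of_nat (i choose m) :: 'a) * absval x ^ (i - m) \<le> 1 * R ^ (i - m)"
      using x absval_of_nat by (intro mult_mono power_mono) auto
    then have "absval (coeff P i * (of_nat (i choose m) * x ^ (i - m))) \<le> absval (coeff P i) * R ^ (i - m)"
      by (simp add: absval_mult absval_power mult_left_mono)
    with lt show "absval (coeff P i * (of_nat (i choose m) * x ^ (i - m))) < absval (coeff P m)" by simp
  qed (use nz in simp)
  then show ?thesis unfolding eq by (rule absval_add_eq)
qed

text \<open>Transports \<open>ex_small_root\<close> from the origin to any centre x of the disc: the
  constant coefficient of the translate is \<open>poly P x\<close>, so a small value at x forces a
  root near x.\<close>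

lemma ex_near_root:
  fixes P :: "'a poly"
  assumes "0 < R" "absval x \<le> R" "0 < m" "coeff P m \<noteq> 0"
    and "\<And>n. m < n \<Longrightarrow> absval (coeff P n) * R ^ n < absval (coeff P m) * R ^ m"
  obtains y where "poly P y = 0" "absval (coeff P m) * absval (y - x) ^ m \<le> absval (poly P x)"
proof -
  let ?P = "pcompose P [:x, 1:]"
  have eq: "absval (coeff ?P m) = absval (coeff P m)" by (rule absval_coeff_translate[OF assms(1,2,4,5)])
  then have "coeff ?P m \<noteq> 0" using assms(4) by (metis absval_eq_0_iff)
  then obtain t where t: "poly ?P t = 0" "absval (coeff ?P m) * absval t ^ m \<le> absval (coeff ?P 0)"
    using ex_small_root[OF assms(3)] by blast
  have "coeff ?P 0 = poly P x" by (simp add: poly_0_coeff_0[symmetric] poly_pcompose)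
  then show ?thesis using that[of "x + t"] t eq by (simp add: poly_pcompose)
qed

text \<open>The roots of successive Taylor polynomials can be chosen to form a Cauchy sequence.\<close>

theorem ex_zero_in_disc:
  fixes h :: "'a fps"
  assumes h: "h \<in> entire" and R: "0 < R" and wd: "wdegree h R \<nu>" and \<nu>: "0 < \<nu>"
  obtains z where "absval z \<le> R" "entire_eval h z = 0"
proof -
  \<comment> \<open>Truncating no earlier than after index \<nu> keeps the dominant coefficient, so
    \<open>ex_near_root\<close> applies to every \<open>T k\<close> with the same exponent
    \<nu>.\<close>
  define T where "T k = truncate_fps (Suc (\<nu> + k)) h" for k
  define a where "a = absval (h $ \<nu>)"
  have a: "0 < a" using wd by (simp add: a_def wdegree_def)
  have le: "absval (h $ n) * R ^ n \<le> a * R ^ \<nu>" for n using wd by (simp add: a_def wdegree_def)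
  have lt: "absval (h $ n) * R ^ n < a * R ^ \<nu>" if "\<nu> < n" for n using wd that by (simp add: a_def wdegree_def)
  have T\<nu>: "coeff (T k) \<nu> = h $ \<nu>" and T0: "coeff (T k) 0 = h $ 0" for k by (simp_all add: T_def)
  have near: "\<exists>y. poly (T k) y = 0 \<and> a * absval (y - x) ^ \<nu> \<le> absval (poly (T k) x)" if "absval x \<le> R" for k x
  proof (rule ex_near_root[OF R that \<nu>, of "T k"])
    show "coeff (T k) \<nu> \<noteq> 0" using a by (simp add: T\<nu> a_def)
    show "absval (coeff (T k) n) * R ^ n < absval (coeff (T k) \<nu>) * R ^ \<nu>" if "\<nu> < n" for n
      using lt[OF that] a R unfolding T\<nu> by (auto simp: T_def coeff_truncate_fps a_def)
  qed (auto simp: T\<nu> a_def)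
  have small: "absval y \<le> R" if "a * absval y ^ \<nu> \<le> a * R ^ \<nu>" for y :: 'a
    using that a \<nu> R by (simp add: power_mono_iff)
  have "\<exists>x. \<forall>k. (absval (x k) \<le> R \<and> poly (T k) (x k) = 0) \<and>
      a * absval (x (Suc k) - x k) ^ \<nu> \<le> absval (h $ Suc (\<nu> + k)) * R ^ Suc (\<nu> + k)"
  proof (rule dependent_nat_choice)
    obtain y where y: "poly (T 0) y = 0" "a * absval (y - 0) ^ \<nu> \<le> absval (poly (T 0) 0)"
      using near[of 0 0] R by auto
    then have "a * absval y ^ \<nu> \<le> a * R ^ \<nu>" using le[of 0] by (simp add: poly_0_coeff_0 T0)
    then show "\<exists>x. absval x \<le> R \<and> poly (T 0) x = 0" using y small by blast
  next
    fix x k assume x: "absval x \<le> R \<and> poly (T k) x = 0"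
    \<comment> \<open>A root of \<open>T k\<close> is nearly a root of the next truncation: the
      value there is the single new term. That term is at most the maximal one, which keeps the new
      root in the disc, and it tends to 0, which makes the roots converge.\<close>
    have "T (Suc k) = T k + monom (h $ Suc (\<nu> + k)) (Suc (\<nu> + k))"
      by (rule poly_eqI) (auto simp: T_def coeff_truncate_fps)
    then have "poly (T (Suc k)) x = h $ Suc (\<nu> + k) * x ^ Suc (\<nu> + k)"
      using x by (simp add: poly_monom)
    then have "absval (poly (T (Suc k)) x) \<le> absval (h $ Suc (\<nu> + k)) * R ^ Suc (\<nu> + k)"
      using x by (simp add: absval_mult absval_power mult_left_mono power_mono del: power_Suc)
    then obtain y where y: "poly (T (Suc k)) y = 0"
        "a * absval (y - x) ^ \<nu> \<le> absval (h $ Suc (\<nu> + k)) * R ^ Suc (\<nu> + k)"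
      using near[of x "Suc k"] x by force
    have "absval (y - x) \<le> R" using y(2) le[of "Suc (\<nu> + k)"] by (intro small) linarith
    then have "absval ((y - x) + x) \<le> R" using x by (intro absval_add_le) auto
    then show "\<exists>y. (absval y \<le> R \<and> poly (T (Suc k)) y = 0) \<and>
        a * absval (y - x) ^ \<nu> \<le> absval (h $ Suc (\<nu> + k)) * R ^ Suc (\<nu> + k)"
      using y by auto
  qed
  then obtain x where x: "\<And>k. absval (x k) \<le> R \<and> poly (T k) (x k) = 0"
    and dx: "\<And>k. a * absval (x (Suc k) - x k) ^ \<nu> \<le> absval (h $ Suc (\<nu> + k)) * R ^ Suc (\<nu> + k)"
    by blast
  have tail: "\<exists>N. \<forall>n\<ge>N. absval (h $ n) * R ^ n < e" if "0 < e" for e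
    using order_tendstoD(2)[OF entire_LIMSEQ[OF h], of R e] R that by (simp add: eventually_sequentially)
  have "(\<lambda>k. absval (x (Suc k) - x k)) \<longlonglongrightarrow> 0"
  proof (rule LIMSEQ_I)
    fix e :: real assume e: "0 < e"
    obtain N where N: "\<And>n. N \<le> n \<Longrightarrow> absval (h $ n) * R ^ n < a * e ^ \<nu>"
      using tail[of "a * e ^ \<nu>"] a e by auto
    have "absval (x (Suc k) - x k) < e" if "N \<le> k" for k
    proof -
      have "a * absval (x (Suc k) - x k) ^ \<nu> < a * e ^ \<nu>"
        using dx[of k] N[of "Suc (\<nu> + k)"] that by linarith
      then have "absval (x (Suc k) - x k) ^ \<nu> < e ^ \<nu>" using a by simp
      then show ?thesis by (rule power_less_imp_less_base) (use e in simp)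
    qed
    then show "\<exists>N. \<forall>k\<ge>N. norm (absval (x (Suc k) - x k) - 0) < e" by auto
  qed
  then have "Cauchy x" by (rule Cauchy_absval_diff)
  then obtain z where z: "x \<longlonglongrightarrow> z" using Cauchy_convergent convergentD by blast
  have zR: "absval z \<le> R" by (rule absval_limit_le[OF z, of 0]) (use x in auto)
  have "(\<lambda>k. absval (entire_eval h (x k))) \<longlonglongrightarrow> 0"
  proof (rule LIMSEQ_I)
    fix e :: real assume e: "0 < e"
    then have "0 < e / 2" by simp
    then obtain N where N: "\<And>n. N \<le> n \<Longrightarrow> absval (h $ n) * R ^ n < e / 2" using tail by blast
    have "absval (entire_eval h (x k)) < e" if "N \<le> k" for k
    proof -
      have "absval (entire_eval (h - fps_of_poly (T k)) (x k)) \<le> e / 2"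
      proof (rule entire_eval_le)
        show "absval ((h - fps_of_poly (T k)) $ n) * R ^ n \<le> e / 2" for n
          using N[of n] that e by (cases "n < Suc (\<nu> + k)") (auto simp: T_def coeff_truncate_fps)
      qed (use h x in auto)
      then show ?thesis using h x e by simp
    qed
    then show "\<exists>N. \<forall>k\<ge>N. norm (absval (entire_eval h (x k)) - 0) < e" by auto
  qed
  then have "(\<lambda>k. entire_eval h (x k)) \<longlonglongrightarrow> 0" by (simp add: tendsto_absval_iff)
  with entire_continuous[OF h z] have "entire_eval h z = 0" by (rule LIMSEQ_unique)
  with zR show ?thesis by (rule that)
qed

section \<open>Surjectivity, polynomials among entire functions, and growth\<close>

text \<open>Subtracting c changes only the constant term and keeps it at most the maximal term, so
  the positive Weierstrass degree \<nu> is unaffected.\<close>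

lemma surj_on_disc:
  fixes h :: "'a fps"
  assumes h: "h \<in> entire" and R: "0 < R" and wd: "wdegree h R \<nu>" and \<nu>: "0 < \<nu>"
    and c: "absval c \<le> absval (h $ \<nu>) * R ^ \<nu>"
  obtains z where "absval z \<le> R" "entire_eval h z = c"
proof -
  have nth: "(h - fps_const c) $ n = (if n = 0 then h $ 0 - c else h $ n)" for n by simp
  have "absval (h $ 0) * R ^ 0 \<le> absval (h $ \<nu>) * R ^ \<nu>" using wd unfolding wdegree_def by blast
  then have "absval (h $ 0 - c) \<le> absval (h $ \<nu>) * R ^ \<nu>" using c by (intro absval_diff_le) auto
  then have "wdegree (h - fps_const c) R \<nu>"
    using wd \<nu> unfolding wdegree_def nth by auto
  then obtain z where "absval z \<le> R" "entire_eval (h - fps_const c) z = 0"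
    using ex_zero_in_disc[OF _ R _ \<nu>] h by (metis entire_diff entire_const)
  then show ?thesis using that h by simp
qed

lemma wdegree_pos:
  assumes "wdegree h R \<nu>" "0 < m" "absval (h $ 0) \<le> absval (h $ m) * R ^ m"
  shows "0 < \<nu>"
proof (rule ccontr)
  assume "\<not> 0 < \<nu>"
  then have "absval (h $ m) * R ^ m < absval (h $ 0) * R ^ 0"
    using assms(1,2) unfolding wdegree_def by simp
  with assms(3) show False by simp
qed

lemma ex_large_radius:
  fixes C c :: real
  assumes "0 < m" "0 < c"
  obtains R where "1 \<le> R" "R0 \<le> R" "C \<le> c * R ^ m"
proof -
  define R where "R = max 1 (max R0 (C / c))"
  have R: "1 \<le> R" "R0 \<le> R" "C / c \<le> R" by (auto simp: R_def)
  have "R \<le> R ^ m" using R assms(1) by (simp add: self_le_power)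
  then have "C / c \<le> R ^ m" using R by simp
  then have "C \<le> c * R ^ m" using assms(2) by (simp add: field_simps)
  then show ?thesis using that R by blast
qed

text \<open>For a large radius some term of positive index outgrows both the constant term and c, so
  \<open>surj_on_disc\<close> applies.\<close>

lemma entire_surj:
  fixes h :: "'a fps"
  assumes h: "h \<in> entire" and nz: "h \<notin> range fps_const"
  obtains z where "entire_eval h z = c"
proof -
  have "h \<noteq> fps_const (h $ 0)" using nz by blast
  then obtain m where "h $ m \<noteq> fps_const (h $ 0) $ m" unfolding fps_eq_iff by blast
  then have m: "0 < m" "h $ m \<noteq> 0" by (cases m; simp)+
  obtain R where R: "1 \<le> R" "max (absval (h $ 0)) (absval c) \<le> absval (h $ m) * R ^ m"
    using ex_large_radius[of m "absval (h $ m)" 0] m by (metis absval_pos_iff)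
  have "h \<noteq> 0" using m by auto
  then obtain \<nu> where wd: "wdegree h R \<nu>" using ex_wdegree[OF h, of R] R by auto
  have "0 < \<nu>" using wdegree_pos[OF wd m(1)] R by simp
  moreover have "absval (h $ m) * R ^ m \<le> absval (h $ \<nu>) * R ^ \<nu>" using wd by (simp add: wdegree_def)
  ultimately obtain z where "entire_eval h z = c"
    using surj_on_disc[OF h _ wd, of c] R by auto
  then show ?thesis by (rule that)
qed

text \<open>Divide out one zero at a time with its full order, so that the number of distinct zeros
  drops; a function without zeros is constant by surjectivity.\<close>

lemma finite_zeros_imp_poly:
  fixes h :: "'a fps"
  assumes h: "h \<in> entire" and fin: "finite {z. entire_eval h z = 0}"
  shows "h \<in> range fps_of_poly"
proof (cases "h = 0")
  case False
  show ?thesis using h fin False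
  proof (induction "card {z. entire_eval h z = 0}" arbitrary: h)
    case 0
    then have "entire_eval h z \<noteq> 0" for z by auto
    then have "h \<in> range fps_const" using entire_surj[OF \<open>h \<in> entire\<close>, of 0] by blast
    then show ?case by (auto simp flip: fps_of_poly_const)
  next
    case (Suc n)
    then have "{z. entire_eval h z = 0} \<noteq> {}" by (metis card.empty Zero_not_Suc)
    then obtain a where a: "entire_eval h a = 0" by blast
    obtain k where "zero_of_order h a k" using ex_zero_of_order Suc.prems by blast
    then obtain g where g: "g \<in> entire" "h = (fps_X - fps_const a) ^ k * g" "entire_eval g a \<noteq> 0"
      by (auto simp: zero_of_order_def)
    have "0 < k" using g a by (cases k) auto
    have Z: "{z. entire_eval g z = 0} = {z. entire_eval h z = 0} - {a}" using g \<open>0 < k\<close> by auto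
    have "n = card {z. entire_eval g z = 0}"
      unfolding Z using Suc.hyps(2) Suc.prems(2) a by simp
    moreover have "finite {z. entire_eval g z = 0}" unfolding Z using Suc.prems(2) by simp
    moreover have "g \<noteq> 0" using g by auto
    ultimately have "g \<in> range fps_of_poly" using Suc.hyps(1) g(1) by blast
    then obtain q where "g = fps_of_poly q" by blast
    moreover have "fps_X - fps_const a = fps_of_poly [:- a, 1:]" by (simp add: fps_of_poly_linear)
    ultimately have "h = fps_of_poly ([:- a, 1:] ^ k * q)"
      unfolding g(2) by (simp only: fps_of_poly_mult fps_of_poly_power)
    then show ?case by blast
  qed
qed (auto intro: image_eqI[of _ _ 0])

lemma entire_eval_at_0:
  fixes f :: "'a fps"
  assumes "f \<in> entire" shows "entire_eval f 0 = f $ 0"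
proof -
  obtain G where "f = fps_const (entire_eval f 0) + (fps_X - fps_const 0) * G"
    using entire_factor[OF assms] by blast
  from arg_cong[OF this, of "\<lambda>f. f $ 0"] show ?thesis by simp
qed

text \<open>The maximum principle, a consequence of \<open>surj_on_disc\<close>, gives Cauchy's estimates.\<close>

lemma Cauchy_estimate:
  fixes U :: "'a fps" and r :: 'a
  assumes U: "U \<in> entire"
  obtains z where "absval z \<le> absval r" "absval (U $ n) * absval r ^ n \<le> absval (entire_eval U z)"
proof (cases "r = 0 \<or> U = 0")
  case True
  then show ?thesis using that[of 0] U by (cases n) (auto simp: entire_eval_at_0)
next
  case False
  then have R: "0 < absval r" by simp
  obtain \<nu> where wd: "wdegree U (absval r) \<nu>" using ex_wdegree[OF U _ R] False by blast
  have le: "absval (U $ n) * absval r ^ n \<le> absval (U $ \<nu>) * absval r ^ \<nu>" using wd by (simp add: wdegree_def)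
  show ?thesis
  proof (cases "\<nu> = 0")
    case True
    then show ?thesis using that[of 0] le U by (simp add: entire_eval_at_0)
  next
    case False
    then obtain z where "absval z \<le> absval r" "entire_eval U z = U $ \<nu> * r ^ \<nu>"
      using surj_on_disc[OF U R wd, of "U $ \<nu> * r ^ \<nu>"] by (auto simp: absval_mult absval_power)
    then show ?thesis using that le by (simp add: absval_mult absval_power)
  qed
qed

text \<open>At a large radius the Cauchy estimate sets \<open>absval r ^ n\<close> against
  \<open>absval r ^ k\<close>. The maximum with 1 in the hypothesis lets one bound cover the unit
  disc too.\<close>

lemma Liouville_nonarch:
  fixes U :: "'a fps"
  assumes U: "U \<in> entire" and bnd: "\<And>z. absval (entire_eval U z) \<le> C * max 1 (absval z) ^ k" and n: "k < n"
  shows "U $ n = 0"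
proof (rule ccontr)
  assume nz: "U $ n \<noteq> 0"
  obtain R where R: "1 \<le> R" "C + 1 \<le> absval (U $ n) * R ^ (n - k)"
    using ex_large_radius[of "n - k" "absval (U $ n)" 0] n nz by (metis absval_pos_iff zero_less_diff)
  obtain r :: 'a where r: "R \<le> absval r" using ex_absval_ge by blast
  obtain z where z: "absval z \<le> absval r" "absval (U $ n) * absval r ^ n \<le> absval (entire_eval U z)"
    using Cauchy_estimate[OF U] by blast
  have "0 \<le> C" using order.trans[OF absval_nonneg bnd[of 0]] by simp
  have "absval (U $ n) * absval r ^ n \<le> C * max 1 (absval z) ^ k" using z(2) bnd[of z] by linarith
  also have "\<dots> \<le> C * absval r ^ k"
    using z(1) r R \<open>0 \<le> C\<close> by (intro mult_left_mono power_mono) auto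
  finally have "(absval (U $ n) * absval r ^ (n - k)) * absval r ^ k \<le> C * absval r ^ k"
    using n by (simp add: mult.assoc flip: power_add)
  moreover have "0 < absval r ^ k" using r R by (intro zero_less_power) linarith
  ultimately have "absval (U $ n) * absval r ^ (n - k) \<le> C" by (rule mult_right_le_imp_le)
  moreover have "absval (U $ n) * R ^ (n - k) \<le> absval (U $ n) * absval r ^ (n - k)"
    using r R by (intro mult_left_mono power_mono) auto
  ultimately show False using R by linarith
qed

section \<open>Compositions of entire functions\<close>

text \<open>Dividing gives H - H(c) = (X - c)^2 H2 and G - c = (X - x) G1. Inserting values, the
  quotient F1 of F - F(x) by X - x is, away from x, the product of z - x and a factor bounded near
  x. Continuity then gives F1(x) = 0, hence a second linear factor.\<close>

lemma multiple_zero_composition: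
  fixes F H G :: "'a fps"
  assumes ent: "F \<in> entire" "H \<in> entire" "G \<in> entire"
    and comp: "\<And>z. entire_eval F z = entire_eval H (entire_eval G z)"
    and nonconst: "F \<notin> range fps_const"
    and crit: "entire_eval (fps_deriv H) (entire_eval G x) = 0"
  shows "multiple_zero (F - fps_const (entire_eval F x)) x"
proof -
  define c where "c = entire_eval G x"
  define L where "L a = fps_X - fps_const (a::'a)" for a
  have L: "L a \<in> entire" "entire_eval (L a) z = z - a" "fps_deriv (L a) = 1" for a z
    by (simp_all add: L_def)
  obtain H1 where H1: "H1 \<in> entire" "H = fps_const (entire_eval H c) + L c * H1"
    using entire_factor[OF ent(2)] unfolding L_def by blast
  have "fps_deriv H = H1 + L c * fps_deriv H1"
    by (subst H1(2)) (simp add: L)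
  then have "entire_eval H1 c = 0" using crit H1 L by (simp add: c_def)
  then obtain H2 where H2: "H2 \<in> entire" "H1 = L c * H2"
    using entire_zero_factor[OF H1(1)] unfolding L_def by blast
  obtain G1 where G1: "G1 \<in> entire" "G = fps_const c + L x * G1"
    using entire_factor[OF ent(3), of x] unfolding L_def c_def by blast
  obtain F1 where F1: "F1 \<in> entire" "F = fps_const (entire_eval F x) + L x * F1"
    using entire_factor[OF ent(1), of x] unfolding L_def by blast
  have Gz: "entire_eval G z = c + (z - x) * entire_eval G1 z" for z
    using arg_cong[OF G1(2), of "\<lambda>f. entire_eval f z"] G1(1) L by simp
  have Hw: "entire_eval H w = entire_eval H c + (w - c)^2 * entire_eval H2 w" for w
    using arg_cong[OF H1(2), of "\<lambda>f. entire_eval f w"] H1(1) H2 L by (simp add: power2_eq_square mult_ac)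
  have Fz: "entire_eval F z = entire_eval F x + (z - x) * entire_eval F1 z" for z
    using arg_cong[OF F1(2), of "\<lambda>f. entire_eval f z"] F1(1) L by simp
  have F1z: "entire_eval F1 z = (z - x) * ((entire_eval G1 z)^2 * entire_eval H2 (entire_eval G z))"
    if "z \<noteq> x" for z
  proof -
    define w where "w = entire_eval G z"
    have wc: "w - c = (z - x) * entire_eval G1 z" using Gz[of z] by (simp add: w_def)
    have "entire_eval F x + (z - x) * entire_eval F1 z = entire_eval H w"
      using Fz[of z] comp[of z] by (simp add: w_def)
    also have "\<dots> = entire_eval F x + (w - c)^2 * entire_eval H2 w"
      using Hw[of w] comp[of x] by (simp add: c_def)
    finally have "(z - x) * entire_eval F1 z = (w - c)^2 * entire_eval H2 w" by simp
    then have "(z - x) * entire_eval F1 z = (z - x) * ((z - x) * ((entire_eval G1 z)^2 * entire_eval H2 (entire_eval G z)))"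
      unfolding wc unfolding w_def by (simp add: power2_eq_square mult_ac)
    then show ?thesis using that by simp
  qed
  have "entire_eval F1 x = 0"
  proof (rule ccontr)
    assume nz: "entire_eval F1 x \<noteq> 0"
    define R where "R = max 1 (absval x)"
    have R: "0 < R" "1 \<le> R" "absval x \<le> R" by (auto simp: R_def)
    obtain B1 where B1: "0 < B1" "\<And>n. absval (G1 $ n) * R ^ n \<le> B1"
      using entire_bound[OF G1(1) R(1)] by blast
    \<comment> \<open>B bounds the values of G on the disc of radius R, so H2 must be bounded on the
      disc of radius B.\<close>
    obtain B where B: "0 < B" "\<And>n. absval (G $ n) * R ^ n \<le> B"
      using entire_bound[OF ent(3) R(1)] by blast
    obtain B2 where B2: "0 < B2" "\<And>n. absval (H2 $ n) * B ^ n \<le> B2"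
      using entire_bound[OF H2(1) B(1)] by blast
    have "\<exists>z::'a. z \<noteq> 0 \<and> absval z < inverse (real (Suc n))" for n by (intro ex_absval_small) simp
    then obtain s :: "nat \<Rightarrow> 'a" where s: "\<And>n. s n \<noteq> 0" "\<And>n. absval (s n) < inverse (real (Suc n))"
      by metis
    have "(\<lambda>n. absval (s n)) \<longlonglongrightarrow> 0"
      by (rule LIMSEQ_0_le[OF LIMSEQ_inverse_real_of_nat])
         (use s(2) in \<open>auto intro!: always_eventually less_imp_le\<close>)
    then have lim: "(\<lambda>n. x + s n) \<longlonglongrightarrow> x" and lim': "(\<lambda>n. absval (s n) * (B1^2 * B2)) \<longlonglongrightarrow> 0"
      by (simp_all add: tendsto_absval_iff tendsto_mult_left_zero)
    have "absval (entire_eval F1 (x + s n)) \<le> absval (s n) * (B1^2 * B2)" for n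
    proof -
      have "absval (s n) \<le> 1"
        using s(2)[of n] inverse_le_1_iff[of "real (Suc n)"] by linarith
      then have z: "absval (x + s n) \<le> R" using R by (intro absval_add_le) auto
      have "absval (entire_eval G1 (x + s n)) \<le> B1" by (rule entire_eval_le[OF G1(1) z B1(2)])
      moreover have "absval (entire_eval H2 (entire_eval G (x + s n))) \<le> B2"
        by (rule entire_eval_le[OF H2(1) entire_eval_le[OF ent(3) z B(2)] B2(2)])
      ultimately show ?thesis
        using s(1) B1 B2 by (simp add: F1z absval_mult absval_power mult_left_mono mult_mono power_mono)
    qed
    then have "(\<lambda>n. absval (entire_eval F1 (x + s n))) \<longlonglongrightarrow> 0"
      by (intro LIMSEQ_0_le[OF lim']) (auto intro: always_eventually)
    then have "(\<lambda>n. entire_eval F1 (x + s n)) \<longlonglongrightarrow> 0" by (simp add: tendsto_absval_iff)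
    with entire_continuous[OF F1(1) lim] nz show False using LIMSEQ_unique by blast
  qed
  then obtain F2 where F2: "F2 \<in> entire" "F1 = L x * F2"
    using entire_zero_factor[OF F1(1)] unfolding L_def by blast
  have "F2 \<noteq> 0"
  proof
    assume "F2 = 0"
    then have "F = fps_const (entire_eval F x)" using F1 F2 by simp
    with nonconst show False by blast
  qed
  \<comment> \<open>\<open>zero_of_order\<close> asks for the exact order, so the order of F2 at x,
    possibly 0, is added to the two factors found.\<close>
  then obtain k where "zero_of_order F2 x k" using ex_zero_of_order F2 by blast
  then obtain g where g: "g \<in> entire" "F2 = L x ^ k * g" "entire_eval g x \<noteq> 0"
    by (auto simp: zero_of_order_def L_def)
  have "F - fps_const (entire_eval F x) = L x * F1"
    using F1(2) by (metis add_diff_cancel_left')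
  then have "F - fps_const (entire_eval F x) = L x ^ (k + 2) * g"
    by (simp add: F2(2) g(2) mult_ac)
  then have "zero_of_order (F - fps_const (entire_eval F x)) x (k + 2)"
    using g unfolding zero_of_order_def L_def by blast
  then show ?thesis unfolding multiple_zero_def by (intro exI[of _ "k + 2"]) simp
qed

theorem entire_composition_trivial:
  fixes F H G :: "'a fps"
  assumes ent: "F \<in> entire" "H \<in> entire" "G \<in> entire"
    and comp: "\<And>z. entire_eval F z = entire_eval H (entire_eval G z)"
    and npoly: "F \<notin> range fps_of_poly"
    and mult: "\<forall>\<beta> x y. multiple_zero (F - fps_const \<beta>) x \<longrightarrow> multiple_zero (F - fps_const \<beta>) y \<longrightarrow> x = y"
  obtains a b where "a \<noteq> 0" "H = fps_of_poly [:b, a:] \<or> G = fps_of_poly [:b, a:]"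
proof -
  have nconst: "F \<notin> range fps_const" using npoly by (auto simp flip: fps_of_poly_const)
  have H_nconst: "H \<notin> range fps_const"
  proof
    assume "H \<in> range fps_const"
    then obtain c where "H = fps_const c" by blast
    then have "F = fps_const c" using comp ent by (intro entire_eqI) auto
    with nconst show False by blast
  qed
  have inj: "x = y" if "entire_eval (fps_deriv H) c = 0" "entire_eval G x = c" "entire_eval G y = c" for x y c
  proof -
    have "entire_eval F x = entire_eval F y" using comp that by simp
    moreover have "multiple_zero (F - fps_const (entire_eval F x)) x" "multiple_zero (F - fps_const (entire_eval F y)) y"
      using multiple_zero_composition[OF ent comp nconst] that by simp_all
    ultimately show ?thesis using mult by metis
  qed
  show ?thesis
  proof (cases "G \<in> range fps_of_poly")
    case False
    have "entire_eval (fps_deriv H) c \<noteq> 0" for c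
    proof
      assume c: "entire_eval (fps_deriv H) c = 0"
      have "{z. entire_eval (G - fps_const c) z = 0} = {z. entire_eval G z = c}" using ent by simp
      moreover have "finite {z. entire_eval G z = c}"
      proof (cases "\<exists>z. entire_eval G z = c")
        case True
        then obtain z where "entire_eval G z = c" by blast
        then have "{z. entire_eval G z = c} \<subseteq> {z}" using inj[OF c] by blast
        then show ?thesis by (rule finite_subset) simp
      qed auto
      ultimately have "G - fps_const c \<in> range fps_of_poly"
        using finite_zeros_imp_poly[of "G - fps_const c"] ent by simp
      then obtain q where "G - fps_const c = fps_of_poly q" by blast
      then have "G = fps_of_poly (q + [:c:])" by (simp add: fps_of_poly_add algebra_simps)
      with False show False by blast
    qed
    then have "fps_deriv H \<in> range fps_const"
      using entire_surj[of "fps_deriv H" 0] ent by (metis entire_deriv)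
    then obtain a where a: "fps_deriv H = fps_const a" by blast
    have "H = fps_of_poly [:H $ 0, a:]"
    proof (rule fps_ext)
      fix n
      \<comment> \<open>In characteristic 0 the factor \<open>of_nat (Suc m)\<close> is invertible,
        so a constant derivative kills all coefficients of index at least 2.\<close>
      have d: "of_nat (Suc m) * H $ Suc m = (if m = 0 then a else 0)" for m
        using arg_cong[OF a, of "\<lambda>f. f $ m"] by (simp del: of_nat_Suc)
      show "H $ n = fps_of_poly [:H $ 0, a:] $ n"
      proof (cases n)
        case (Suc m)
        then show ?thesis using d[of m] by (cases m) (auto simp del: of_nat_Suc)
      qed simp
    qed
    moreover have "a \<noteq> 0" using calculation H_nconst by (auto simp flip: fps_of_poly_const)
    ultimately show ?thesis using that by blast
  next
    case True
    then obtain Q where Q: "G = fps_of_poly Q" by blast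
    have QG: "entire_eval G z = poly Q z" for z by (simp add: Q)
    have "degree Q \<noteq> 0"
    proof
      assume "degree Q = 0"
      then obtain c where "Q = [:c:]" using degree_0_id by metis
      then have "F = fps_const (entire_eval H c)" using comp ent by (intro entire_eqI) (auto simp: QG)
      with nconst show False by blast
    qed
    moreover have "\<not> 2 \<le> degree Q"
    proof
      assume deg: "2 \<le> degree Q"
      define l where "l = lead_coeff Q"
      text \<open>A fibre with a single point is a critical value of \<open>Q\<close> of maximal multiplicity, and \<open>Q\<close>
        has only one such value.\<close>
      have single: "\<exists>\<alpha>. Q = [:c:] + smult l ([:- \<alpha>, 1:] ^ degree Q)"
        if c: "entire_eval (fps_deriv H) c = 0" for c
      proof -
        define P where "P = Q - [:c:]"
        have degP: "degree P = degree Q" "lead_coeff P = lead_coeff Q"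
        proof -
          have PQ: "P = Q + [:- c:]" by (simp add: P_def)
          show "degree P = degree Q" unfolding PQ using deg by (intro degree_add_eq_left) simp
          then show "lead_coeff P = lead_coeff Q" using deg by (simp add: PQ coeff_eq_0)
        qed
        obtain \<alpha> where \<alpha>: "poly P \<alpha> = 0" using alg_closed[of P] deg degP by auto
        have uniq: "y = \<alpha>" if "poly P y = 0" for y
          using inj[OF c, of y \<alpha>] that \<alpha> by (simp add: QG P_def)
        \<comment> \<open>Roots exist in every positive degree and can only be \<alpha>, so the same
          linear factor splits off until the degree is 0.\<close>
        have "P = smult (lead_coeff P) ([:- \<alpha>, 1:] ^ degree P)"
          using uniq
        proof (induction "degree P" arbitrary: P)
          case 0
          then show ?case using degree_0_id[of P] by simp
        next
          case (Suc n)
          then obtain y where "poly P y = 0" using alg_closed[of P] by auto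
          then have "poly P \<alpha> = 0" using Suc.prems by blast
          then obtain P' where P': "P = [:- \<alpha>, 1:] * P'" using poly_eq_0_iff_dvd by (metis dvdE)
          have "P' \<noteq> 0" using P' Suc.hyps(2) by auto
          then have deg': "degree P = Suc (degree P')" unfolding P' by (subst degree_mult_eq) auto
          have lead': "lead_coeff P = lead_coeff P'" unfolding P' lead_coeff_mult by simp
          have IH: "P' = smult (lead_coeff P') ([:- \<alpha>, 1:] ^ degree P')"
          proof (rule Suc.hyps(1))
            show "n = degree P'" using Suc.hyps(2) deg' by simp
            show "y = \<alpha>" if "poly P' y = 0" for y using Suc.prems[of y] that by (simp add: P')
          qed
          have "P = [:- \<alpha>, 1:] * smult (lead_coeff P') ([:- \<alpha>, 1:] ^ degree P')"
            using P' IH by simp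
          also have "\<dots> = smult (lead_coeff P) ([:- \<alpha>, 1:] ^ degree P)"
            unfolding lead' unfolding deg' by (simp only: mult_smult_right power_Suc)
          finally show ?case .
        qed
        then have "P = smult l ([:- \<alpha>, 1:] ^ degree Q)" using degP unfolding l_def by simp
        moreover have "Q = [:c:] + P" by (simp add: P_def)
        ultimately show ?thesis by blast
      qed
      \<comment> \<open>Otherwise H would be a polynomial, again by characteristic 0, and so would
        its composition F with the polynomial Q.\<close>
      have "fps_deriv H \<notin> range fps_of_poly"
      proof
        assume "fps_deriv H \<in> range fps_of_poly"
        then obtain q where q: "fps_deriv H = fps_of_poly q" by blast
        have "H $ n = 0" if "Suc (degree q) < n" for n
        proof -
          from that have "n \<noteq> 0" by simp
          then obtain m where m: "n = Suc m" by (cases n) auto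
          have "of_nat (Suc m) * H $ Suc m = coeff q m"
            using arg_cong[OF q, of "\<lambda>f. f $ m"] by (simp del: of_nat_Suc)
          then show ?thesis using that m by (auto simp: coeff_eq_0 simp del: of_nat_Suc)
        qed
        then have "H = fps_of_poly (truncate_fps (Suc (Suc (degree q))) H)"
          by (auto simp: fps_eq_iff)
        then obtain P where "H = fps_of_poly P" by blast
        then have "F = fps_of_poly (pcompose P Q)" 
          using comp ent by (intro entire_eqI) (auto simp: QG poly_pcompose)
        with npoly show False by blast
      qed
      then have inf: "infinite {c. entire_eval (fps_deriv H) c = 0}"
        using finite_zeros_imp_poly[of "fps_deriv H"] ent by auto
      then obtain c1 where c1: "entire_eval (fps_deriv H) c1 = 0" using infinite_imp_nonempty by blast
      have "infinite ({c. entire_eval (fps_deriv H) c = 0} - {c1})" using inf by simp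
      then obtain c2 where "entire_eval (fps_deriv H) c2 = 0" "c1 \<noteq> c2" using infinite_imp_nonempty by blast
      note c = c1 this
      obtain \<alpha>1 where 1: "Q = [:c1:] + smult l ([:- \<alpha>1, 1:] ^ degree Q)" using single c by blast
      obtain \<alpha>2 where 2: "Q = [:c2:] + smult l ([:- \<alpha>2, 1:] ^ degree Q)" using single c by blast
      obtain d where d: "degree Q = Suc (Suc d)" using deg by (metis add_2_eq_Suc le_Suc_ex)
      have lc: "l \<noteq> 0" using deg by (auto simp: l_def)
      \<comment> \<open>Each presentation makes its centre \<beta> the only zero of
        \<open>pderiv Q\<close>, the exponent \<open>Suc d\<close> being positive. Hence the two
        centres agree, and with them c1 and c2.\<close>
      have der: "poly (pderiv Q) \<alpha> = l * of_nat (Suc (Suc d)) * (\<alpha> - \<beta>) ^ Suc d"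
        if "Q = [:c:] + smult l ([:- \<beta>, 1:] ^ Suc (Suc d))" for \<alpha> \<beta> c
        by (subst that) (simp add: pderiv_add pderiv_smult pderiv_power_Suc pderiv_pCons del: power_Suc of_nat_Suc)
      have "poly (pderiv Q) \<alpha>1 = 0" using der[of c1 \<alpha>1 \<alpha>1] 1 d by simp
      moreover have "poly (pderiv Q) \<alpha>1 = l * of_nat (Suc (Suc d)) * (\<alpha>1 - \<alpha>2) ^ Suc d"
        using der[of c2 \<alpha>2 \<alpha>1] 2 d by simp
      ultimately have "\<alpha>1 = \<alpha>2" using lc by (auto simp del: of_nat_Suc)
      with 1 2 have "[:c1:] = [:c2:]" by (metis add_right_cancel)
      with c(3) show False by simp
    qed
    ultimately have deg: "degree Q = 1" by linarith
    then have "Q = [:coeff Q 0, coeff Q 1:]"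
      by (intro poly_eqI) (auto simp: coeff_pCons coeff_eq_0 split: nat.split)
    moreover have "coeff Q 1 \<noteq> 0" using deg by (metis leading_coeff_0_iff degree_0 zero_neq_one)
    ultimately show ?thesis using that Q by metis
  qed
qed

end

section \<open>Meromorphic functions\<close>

context nontrivial_nonarch_field
begin

lemma Fract_eq_iff:
  fixes u v f g :: "'a fps"
  shows "v \<noteq> 0 \<Longrightarrow> g \<noteq> 0 \<Longrightarrow> Fract u v = Fract f g \<longleftrightarrow> u * g = f * v"
  by (simp add: eq_fract)

lemma mero_value_Fract:
  fixes f g :: "'a fps"
  shows "f \<in> entire \<Longrightarrow> g \<in> entire \<Longrightarrow> entire_eval g z \<noteq> 0 \<Longrightarrow>
    mero_value (Fract f g) z (entire_eval f z / entire_eval g z)"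
  unfolding mero_value_def by blast

lemma mero_value_cross:
  fixes u v :: "'a fps"
  assumes uv: "u \<in> entire" "v \<in> entire" "v \<noteq> 0" and val: "mero_value (Fract u v) z w"
  obtains f g where "f \<in> entire" "g \<in> entire" "entire_eval g z \<noteq> 0" "w = entire_eval f z / entire_eval g z"
    "Fract u v = Fract f g" "g \<noteq> 0" "u * g = f * v"
proof -
  obtain f g where fg: "f \<in> entire" "g \<in> entire" "Fract u v = Fract f g" "entire_eval g z \<noteq> 0"
    "w = entire_eval f z / entire_eval g z"
    using val unfolding mero_value_def by blast
  moreover have "g \<noteq> 0" using fg(4) by auto
  moreover have "u * g = f * v" using fg(3) Fract_eq_iff[OF uv(3) \<open>g \<noteq> 0\<close>] by blast
  ultimately show ?thesis by (intro that)
qed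

lemma mero_value_unique:
  fixes m :: "'a fps fract"
  assumes "mero_value m z w" "mero_value m z w'"
  shows "w = w'"
proof -
  obtain f g where fg: "f \<in> entire" "g \<in> entire" "m = Fract f g" "entire_eval g z \<noteq> 0"
    "w = entire_eval f z / entire_eval g z"
    using assms(1) unfolding mero_value_def by blast
  have "g \<noteq> 0" using fg(4) by auto
  then obtain f' g' where fg': "f' \<in> entire" "g' \<in> entire" "entire_eval g' z \<noteq> 0"
    "w' = entire_eval f' z / entire_eval g' z" "f * g' = f' * g"
    using mero_value_cross[OF fg(1,2)] assms(2) fg(3) by metis
  have "entire_eval f z * entire_eval g' z = entire_eval f' z * entire_eval g z"
    using arg_cong[OF fg'(5), of "\<lambda>f. entire_eval f z"] fg(1,2) fg'(1,2) by simp
  then show ?thesis using fg(4,5) fg'(3,4) by (simp add: frac_eq_eq)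
qed

lemma mero_eval_eq_Some:
  fixes m :: "'a fps fract"
  shows "mero_eval m z = Some w \<longleftrightarrow> mero_value m z w"
proof
  assume "mero_value m z w"
  then have "\<exists>w. mero_value m z w" "(THE w. mero_value m z w) = w"
    using mero_value_unique by (blast intro: the_equality)+
  then show "mero_eval m z = Some w" by (simp add: mero_eval_def)
next
  assume "mero_eval m z = Some w"
  then have *: "\<exists>w. mero_value m z w" "(THE w. mero_value m z w) = w"
    by (auto simp: mero_eval_def split: if_splits)
  then obtain w' where "mero_value m z w'" by blast
  moreover have "w' = w" using * calculation mero_value_unique by (metis the_equality)
  ultimately show "mero_value m z w" by simp
qed

lemma mero_eval_Fract:
  fixes f g :: "'a fps"
  shows "f \<in> entire \<Longrightarrow> g \<in> entire \<Longrightarrow> entire_eval g z \<noteq> 0 \<Longrightarrow>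
    mero_eval (Fract f g) z = Some (entire_eval f z / entire_eval g z)"
  by (simp add: mero_eval_eq_Some mero_value_Fract)

lemma mero_eval_entire:
  fixes f :: "'a fps"
  shows "f \<in> entire \<Longrightarrow> mero_eval (Fract f 1) z = Some (entire_eval f z)"
  using mero_eval_Fract[of f 1 z] by simp

lemma linear_nz [simp]: "fps_X - fps_const (a::'a) \<noteq> 0"
proof
  assume "fps_X - fps_const a = 0"
  from arg_cong[OF this, of "\<lambda>f. f $ 1"] show False by simp
qed

text \<open>Split off the full powers of the linear factor at a from numerator and denominator. If
  the power in the denominator were not the larger one, cancelling would give m a value at
  a.\<close>

lemma pole_form:
  fixes m :: "'a fps fract"
  assumes m: "m \<in> meromorphic_Cp" and pole: "mero_eval m a = None"
  obtains k u v where "0 < k" "u \<in> entire" "v \<in> entire" "entire_eval u a \<noteq> 0" "entire_eval v a \<noteq> 0"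
    "m = Fract u ((fps_X - fps_const a) ^ k * v)"
proof -
  let ?L = "fps_X - fps_const a"
  obtain f g where fg: "f \<in> entire" "g \<in> entire" "g \<noteq> 0" "m = Fract f g"
    using m unfolding meromorphic_Cp_def by blast
  have "f \<noteq> 0"
  proof
    assume "f = 0"
    then have "m = Fract 0 1" using fg by (simp add: eq_fract)
    then show False using pole mero_eval_entire[of 0 a] by simp
  qed
  then obtain i where "zero_of_order f a i" using ex_zero_of_order fg by blast
  then obtain u where u: "u \<in> entire" "f = ?L ^ i * u" "entire_eval u a \<noteq> 0"
    by (auto simp: zero_of_order_def)
  obtain j where "zero_of_order g a j" using ex_zero_of_order fg by blast
  then obtain v where v: "v \<in> entire" "g = ?L ^ j * v" "entire_eval v a \<noteq> 0"
    by (auto simp: zero_of_order_def)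
  have nz: "?L ^ n \<noteq> 0" for n by simp
  have "i < j"
  proof (rule ccontr)
    assume "\<not> i < j"
    then have "f = ?L ^ j * (?L ^ (i - j) * u)" by (simp add: u(2) flip: mult.assoc power_add)
    then have "m = Fract (?L ^ (i - j) * u) v" using fg(4) v(2) mult_fract_cancel[OF nz] by metis
    then show False using pole mero_eval_Fract[of "?L ^ (i - j) * u" v a] u v by simp
  qed
  then have "g = ?L ^ i * (?L ^ (j - i) * v)" by (simp add: v(2) flip: mult.assoc power_add)
  then have "m = Fract u (?L ^ (j - i) * v)" using fg(4) u(2) mult_fract_cancel[OF nz] by metis
  then show ?thesis using that[of "j - i"] \<open>i < j\<close> u v by simp
qed

text \<open>Multiplying A by a denominator of m makes it vanish also at the zeros of that
  denominator, the only points where m can be infinite.\<close>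

lemma mero_identity:
  fixes A :: "'a fps" and m :: "'a fps fract"
  assumes m: "m \<in> meromorphic_Cp" and A: "A \<in> entire"
    and zero: "\<And>z w. mero_eval m z = Some w \<Longrightarrow> entire_eval A z = 0"
  shows "A = 0"
proof -
  obtain f g where fg: "f \<in> entire" "g \<in> entire" "g \<noteq> 0" "m = Fract f g"
    using m unfolding meromorphic_Cp_def by blast
  have "entire_eval (A * g) z = 0" for z
    using zero[of z] mero_eval_Fract[OF fg(1,2), of z] fg A by (cases "entire_eval g z = 0") auto
  then have "A * g = 0" using A fg by (intro entire_eq_0) auto
  then show ?thesis using fg(3) by simp
qed

text \<open>Solving \<open>u = q * v\<close> recursively for the coefficients of q divides only by
  \<open>v $ 0\<close>, which dominates all terms of v at radius R; the bound for u thus passes to q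
  up to this one factor.\<close>

lemma quotient_bound:
  fixes u v q :: "'a fps"
  assumes R: "0 < R" and u: "u \<in> entire" and uq: "u = q * v" and wd: "wdegree v R 0"
  shows "\<exists>B. \<forall>n. absval (q $ n) * R ^ n \<le> B"
proof -
  define c where "c = absval (v $ 0)"
  have c: "0 < c" and vle: "absval (v $ n) * R ^ n \<le> c" for n
    using wd by (auto simp: wdegree_def c_def)
  obtain B where B: "0 < B" "\<And>n. absval (u $ n) * R ^ n \<le> B" using entire_bound[OF u R] by blast
  have "absval (q $ n) * R ^ n \<le> B / c" for n
  proof (induction n rule: less_induct)
    case (less n)
    have "(\<Sum>i=0..n. q $ i * v $ (n - i)) = (\<Sum>i<n. q $ i * v $ (n - i)) + q $ n * v $ 0"
      by (simp add: atLeast0AtMost lessThan_Suc_atMost[symmetric])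
    then have eq: "q $ n * v $ 0 = u $ n - (\<Sum>i<n. q $ i * v $ (n - i))"
      unfolding uq by (simp add: fps_mult_nth)
    have "absval (\<Sum>i<n. q $ i * v $ (n - i)) \<le> B / R ^ n"
    proof (rule absval_sum_le)
      fix i assume i: "i \<in> {..<n}"
      then have "R ^ n = R ^ i * R ^ (n - i)" by (simp flip: power_add)
      then have "absval (q $ i * v $ (n - i)) * R ^ n = (absval (q $ i) * R ^ i) * (absval (v $ (n - i)) * R ^ (n - i))"
        by (simp only: absval_mult mult_ac)
      also have "\<dots> \<le> B / c * c" using less[of i] i B R c by (intro mult_mono vle) auto
      finally show "absval (q $ i * v $ (n - i)) \<le> B / R ^ n" using R c by (simp add: pos_le_divide_eq)
    qed (use B R in auto)
    moreover have "absval (u $ n) \<le> B / R ^ n" using B(2)[of n] R by (simp add: pos_le_divide_eq)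
    ultimately have "absval (q $ n * v $ 0) \<le> B / R ^ n" unfolding eq by (intro absval_diff_le)
    then show ?case using R c by (simp add: absval_mult c_def field_simps)
  qed
  then show ?thesis by blast
qed

end

context nonarch_alg_closed
begin

text \<open>Dividing out the finitely many zeros of the denominator in a disc reduces to a denominator of
  Weierstrass degree 0, whose inverse is bounded there.\<close>

lemma quotient_bound_no_poles:
  fixes u v q :: "'a fps"
  assumes R: "0 < R" and "u \<in> entire" "v \<in> entire" "u = q * v" "wdegree v R \<nu>"
    and "\<And>z. absval z \<le> R \<Longrightarrow> \<exists>u'\<in>entire. \<exists>v'\<in>entire. u * v' = u' * v \<and> entire_eval v' z \<noteq> 0"
  shows "\<exists>B. \<forall>n. absval (q $ n) * R ^ n \<le> B"
  using assms(2-)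
proof (induction \<nu> arbitrary: u v)
  case 0
  then show ?case using quotient_bound[OF R] by blast
next
  case (Suc \<nu>)
  obtain a where a: "absval a \<le> R" "entire_eval v a = 0"
    using ex_zero_in_disc[OF Suc.prems(2) R Suc.prems(4)] by auto
  obtain v1 where v1: "v1 \<in> entire" "v = (fps_X - fps_const a) * v1"
    using entire_zero_factor[OF Suc.prems(2) a(2)] by blast
  \<comment> \<open>A representation that is regular at a forces u to vanish there together with v,
    so the linear factor cancels.\<close>
  obtain u' v' where u': "u' \<in> entire" "v' \<in> entire" "u * v' = u' * v" "entire_eval v' a \<noteq> 0"
    using Suc.prems(5)[OF a(1)] by blast
  have "entire_eval u a * entire_eval v' a = entire_eval u' a * entire_eval v a"
    using arg_cong[OF u'(3), of "\<lambda>f. entire_eval f a"] u'(1,2) Suc.prems(1,2) by simp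
  then have "entire_eval u a = 0" using a u' by simp
  then obtain u1 where u1: "u1 \<in> entire" "u = (fps_X - fps_const a) * u1"
    using entire_zero_factor[OF Suc.prems(1)] by blast
  have cancel: "(fps_X - fps_const a) * x = (fps_X - fps_const a) * y \<longleftrightarrow> x = y" for x y :: "'a fps"
    using linear_nz[of a] by (simp only: mult_cancel_left simp_thms)
  show ?case
  proof (rule Suc.IH[OF u1(1) v1(1)])
    have "(fps_X - fps_const a) * u1 = (fps_X - fps_const a) * (q * v1)"
      using Suc.prems(3) unfolding u1(2) v1(2) by (simp only: mult_ac)
    then show "u1 = q * v1" by (simp only: cancel)
    show "wdegree v1 R \<nu>" using wdegree_factor(2)[OF Suc.prems(4) R a(1) v1] by simp
    fix z :: 'a assume "absval z \<le> R"
    then obtain s t where st: "s \<in> entire" "t \<in> entire" "u * t = s * v" "entire_eval t z \<noteq> 0"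
      using Suc.prems(5) by blast
    have "(fps_X - fps_const a) * (u1 * t) = (fps_X - fps_const a) * (s * v1)"
      using st(3) unfolding u1(2) v1(2) by (simp only: mult_ac)
    then have "u1 * t = s * v1" by (simp only: cancel)
    then show "\<exists>u'\<in>entire. \<exists>v'\<in>entire. u1 * v' = u' * v1 \<and> entire_eval v' z \<noteq> 0"
      using st by blast
  qed
qed

text \<open>The quotient first exists as a formal power series: a representation regular at 0 has an
  invertible denominator. The bounds at all radii then show that this series is entire.\<close>

theorem mero_no_poles_entire:
  fixes m :: "'a fps fract"
  assumes m: "m \<in> meromorphic_Cp" and np: "\<And>z. mero_eval m z \<noteq> None"
  obtains h where "h \<in> entire" "m = Fract h 1"
proof -
  obtain u v where uv: "u \<in> entire" "v \<in> entire" "v \<noteq> 0" "m = Fract u v"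
    using m unfolding meromorphic_Cp_def by blast
  have loc: "\<exists>u'\<in>entire. \<exists>v'\<in>entire. u * v' = u' * v \<and> entire_eval v' z \<noteq> 0" for z
  proof -
    obtain w where "mero_value (Fract u v) z w" using np[of z] mero_eval_eq_Some uv(4) by blast
    then show ?thesis using mero_value_cross[OF uv(1-3)] by metis
  qed
  obtain u0 v0 where 0: "u0 \<in> entire" "v0 \<in> entire" "u * v0 = u0 * v" "entire_eval v0 0 \<noteq> 0"
    using loc[of 0] by blast
  have "v0 $ 0 \<noteq> 0" using 0 entire_eval_at_0 by metis
  then have inv: "v0 * inverse v0 = 1" using inverse_mult_eq_1' by blast
  define q where "q = u0 * inverse v0"
  have "u = u * (v0 * inverse v0)" by (simp add: inv)
  also have "\<dots> = u0 * v * inverse v0" using 0(3) by (simp flip: mult.assoc)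
  finally have uq: "u = q * v" by (simp add: q_def mult_ac)
  have "q \<in> entire"
    unfolding entire_iff
  proof (intro allI impI)
    fix R :: real assume R: "0 < R"
    obtain \<nu> where "wdegree v R \<nu>" using ex_wdegree[OF uv(2,3) R] by blast
    then show "\<exists>B. \<forall>n. absval (q $ n) * R ^ n \<le> B"
      using quotient_bound_no_poles[OF R uv(1,2) uq] loc by blast
  qed
  moreover have "m = Fract q 1" using uq uv by (simp add: eq_fract)
  ultimately show ?thesis by (rule that)
qed

section \<open>Values of a meromorphic function near a pole\<close>

text \<open>Each cancelled common zero lowers the Weierstrass degree of v. The restriction to a disc
  is what makes finitely many cancellations enough.\<close>

lemma coprime_on_disc:
  fixes u v :: "'a fps"
  assumes R: "0 < R" and "u \<in> entire" "v \<in> entire" "v \<noteq> 0"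
  shows "\<exists>u'\<in>entire. \<exists>v'\<in>entire. v' \<noteq> 0 \<and> Fract u v = Fract u' v' \<and>
    (\<forall>z. absval z \<le> R \<longrightarrow> entire_eval u' z \<noteq> 0 \<or> entire_eval v' z \<noteq> 0)"
proof -
  obtain \<nu> where "wdegree v R \<nu>" using ex_wdegree[OF assms(3,4) R] by blast
  then show ?thesis using assms(2-)
  proof (induction \<nu> arbitrary: u v rule: less_induct)
    case (less \<nu>)
    show ?case
    proof (cases "\<exists>z. absval z \<le> R \<and> entire_eval u z = 0 \<and> entire_eval v z = 0")
      case True
      then obtain a where a: "absval a \<le> R" "entire_eval u a = 0" "entire_eval v a = 0" by blast
      obtain u1 where u1: "u1 \<in> entire" "u = (fps_X - fps_const a) * u1"
        using entire_zero_factor[OF less.prems(2) a(2)] by blast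
      obtain v1 where v1: "v1 \<in> entire" "v = (fps_X - fps_const a) * v1"
        using entire_zero_factor[OF less.prems(3) a(3)] by blast
      have "0 < \<nu>" "wdegree v1 R (\<nu> - 1)" using wdegree_factor[OF less.prems(1) R a(1) v1] by auto
      moreover have "v1 \<noteq> 0" using v1 less.prems by auto
      moreover have "Fract u v = Fract u1 v1"
        unfolding u1(2) v1(2) by (rule mult_fract_cancel) simp
      ultimately show ?thesis using less.IH[of "\<nu> - 1" v1 u1] u1(1) v1(1) by simp
    next
      case False
      then show ?thesis using less.prems by blast
    qed
  qed
qed

text \<open>The equation u / v = w asks for a zero of v - u / w. For large w this perturbation keeps
  the Weierstrass degree of v, which is positive because v vanishes at the pole. Coprimality ensures
  that the zero found is a genuine point with value w.\<close>

lemma large_values_near_pole: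
  fixes m :: "'a fps fract"
  assumes m: "m \<in> meromorphic_Cp" and pole: "mero_eval m a = None"
  obtains R B where "0 < R" "\<And>w. B \<le> absval w \<Longrightarrow> \<exists>z. absval z \<le> R \<and> mero_eval m z = Some w"
proof -
  define R where "R = max 1 (absval a)"
  have R: "0 < R" "absval a \<le> R" by (auto simp: R_def)
  obtain f g where fg: "f \<in> entire" "g \<in> entire" "g \<noteq> 0" "m = Fract f g"
    using m unfolding meromorphic_Cp_def by blast
  obtain u v where uv: "u \<in> entire" "v \<in> entire" "v \<noteq> 0" "m = Fract u v"
    and cop: "\<And>z. absval z \<le> R \<Longrightarrow> entire_eval u z \<noteq> 0 \<or> entire_eval v z \<noteq> 0"
    using coprime_on_disc[OF R(1) fg(1-3)] fg(4) by metis
  have va: "entire_eval v a = 0" using pole mero_eval_Fract[OF uv(1,2), of a] uv(4) by auto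
  obtain \<nu> where wd: "wdegree v R \<nu>" using ex_wdegree[OF uv(2,3) R(1)] by blast
  have \<nu>: "0 < \<nu>" using wdegree_0_no_zero[OF _ R uv(2)] wd va by (cases "\<nu> = 0") auto
  define M where "M = absval (v $ \<nu>) * R ^ \<nu>"
  have M: "0 < M" using wd R by (simp add: M_def wdegree_def)
  have vle: "absval (v $ n) * R ^ n \<le> M" for n using wd by (simp add: M_def wdegree_def)
  have vlt: "absval (v $ n) * R ^ n < M" if "\<nu> < n" for n using wd that by (simp add: M_def wdegree_def)
  obtain Bu where Bu: "0 < Bu" "\<And>n. absval (u $ n) * R ^ n \<le> Bu" using entire_bound[OF uv(1) R(1)] by blast
  \<comment> \<open>The factor 2 makes the perturbation strictly smaller than the maximal term
    M.\<close>
  have "\<exists>z. absval z \<le> R \<and> mero_eval m z = Some w" if w: "2 * Bu / M \<le> absval w" for w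
  proof -
    have w0: "0 < absval w" using w M Bu by (smt (verit) divide_pos_pos)
    define t where "t = inverse w"
    define d where "d = v - fps_const t * u"
    have tu: "absval (t * u $ n) * R ^ n < M" for n
    proof -
      have "absval (t * u $ n) * R ^ n = absval (u $ n) * R ^ n / absval w"
        by (simp add: t_def absval_mult absval_inverse divide_inverse)
      also have "\<dots> \<le> Bu / absval w" using Bu(2)[of n] w0 by (intro divide_right_mono) auto
      also have "\<dots> < M"
      proof -
        have "2 * Bu \<le> M * absval w" using w M by (simp add: pos_divide_le_eq mult.commute)
        then have "Bu < M * absval w" using Bu(1) by linarith
        then show ?thesis using w0 by (simp add: pos_divide_less_eq)
      qed
      finally show ?thesis .
    qed
    have dn: "d $ n = v $ n + (- (t * u $ n))" for n by (simp add: d_def)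
    have "absval (d $ \<nu>) = absval (v $ \<nu>)"
      unfolding dn using tu[of \<nu>] R by (intro absval_add_eq) (simp add: M_def)
    moreover have "absval (d $ n) * R ^ n \<le> M" for n
    proof -
      have "absval (d $ n) \<le> M / R ^ n"
        unfolding dn using vle[of n] tu[of n] R by (intro absval_add_le) (auto simp: pos_le_divide_eq)
      then show ?thesis using R by (simp add: pos_le_divide_eq)
    qed
    moreover have "absval (d $ n) * R ^ n < M" if "\<nu> < n" for n
    proof -
      have "absval (d $ n) < M / R ^ n"
        unfolding dn using vlt[OF that] tu[of n] R by (intro absval_add_less) (auto simp: pos_less_divide_eq)
      then show ?thesis using R by (simp add: pos_less_divide_eq)
    qed
    moreover have "v $ \<nu> \<noteq> 0" using wd by (simp add: wdegree_def)
    ultimately have "wdegree d R \<nu>"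
      unfolding wdegree_def M_def by (metis absval_eq_0_iff)
    moreover have d: "d \<in> entire" using uv by (simp add: d_def)
    ultimately obtain z where z: "absval z \<le> R" "entire_eval d z = 0"
      using ex_zero_in_disc[OF _ R(1) _ \<nu>] by blast
    then have eq: "entire_eval v z = t * entire_eval u z" using uv by (simp add: d_def)
    have "w \<noteq> 0" using w0 by simp
    then have "t \<noteq> 0" by (simp add: t_def)
    then have "entire_eval u z \<noteq> 0" "entire_eval v z \<noteq> 0" using eq cop[OF z(1)] by auto
    moreover have "entire_eval u z / entire_eval v z = w"
      using calculation \<open>w \<noteq> 0\<close> by (simp add: eq t_def field_simps)
    ultimately show ?thesis using mero_eval_Fract[OF uv(1,2), of z] z uv(4) by auto
  qed
  then show ?thesis using that R(1) by blast
qed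

section \<open>Compositions of meromorphic functions\<close>

lemma entire_poly_compose:
  fixes h :: "'a fps"
  assumes "h \<in> entire"
  obtains C where "C \<in> entire" "\<And>z. entire_eval C z = poly T (entire_eval h z)"
proof -
  have "\<exists>C\<in>entire. \<forall>z. entire_eval C z = poly T (entire_eval h z)"
  proof (induction T)
    case (pCons c T)
    then obtain C where "C \<in> entire" "\<forall>z. entire_eval C z = poly T (entire_eval h z)" by blast
    then show ?case using assms by (intro bexI[of _ "fps_const c + h * C"]) auto
  qed (intro bexI[of _ 0]; simp)
  then show ?thesis using that by blast
qed

text \<open>Large w are values of g on a fixed disc, where F is bounded, so U(w) = F(z) (w - a)^k
  grows at most like the k-th power of w. The case k = 0 serves to show that f has a pole, as it
  would be constant otherwise.\<close>

lemma entire_factor_of_entire_composition: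
  fixes F :: "'a fps" and f g :: "'a fps fract"
  assumes F: "F \<in> entire" and g: "g \<in> meromorphic_Cp" and comp: "is_composition (Fract F 1) f g"
    and nconst: "F \<notin> range fps_const" and pole: "mero_eval g b = None"
    and U: "U \<in> entire" and f: "f = Fract U ((fps_X - fps_const a) ^ k)"
  obtains P where "U = fps_of_poly P" "degree P \<le> k"
proof -
  obtain R B where R: "0 < R" and B: "\<And>w. B \<le> absval w \<Longrightarrow> \<exists>z. absval z \<le> R \<and> mero_eval g z = Some w"
    using large_values_near_pole[OF g pole] by blast
  obtain BF where BF: "0 < BF" "\<And>n. absval (F $ n) * R ^ n \<le> BF" using entire_bound[OF F R] by blast
  \<comment> \<open>Beyond radius S, w is attained by g, differs from a, and satisfies |w - a| \<le>
    |w|.\<close>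
  define S where "S = max (max 1 B) (absval a + 1)"
  have S: "1 \<le> S" "B \<le> S" "absval a < S" by (auto simp: S_def)
  obtain BU where BU: "0 < BU" "\<And>n. absval (U $ n) * S ^ n \<le> BU" using entire_bound[OF U, of S] S by auto
  have "absval (entire_eval U w) \<le> max BF BU * max 1 (absval w) ^ k" for w
  proof (cases "absval w \<le> S")
    case True
    have "absval (entire_eval U w) \<le> BU" by (rule entire_eval_le[OF U True BU(2)])
    also have "\<dots> \<le> max BF BU * 1" by simp
    also have "\<dots> \<le> max BF BU * max 1 (absval w) ^ k"
      using BF(1) by (intro mult_left_mono one_le_power) auto
    finally show ?thesis .
  next
    case False
    then obtain z where z: "absval z \<le> R" "mero_eval g z = Some w" using B[of w] S by auto
    have "w \<noteq> a" using False S by auto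
    then have "mero_eval f w = Some (entire_eval U w / (w - a) ^ k)"
      unfolding f using mero_eval_Fract[of U "(fps_X - fps_const a) ^ k" w] U by simp
    moreover have "mero_eval f w = Some (entire_eval F z)"
      using comp z(2) mero_eval_entire[OF F] unfolding is_composition_def by metis
    ultimately have "entire_eval U w = entire_eval F z * (w - a) ^ k" using \<open>w \<noteq> a\<close> by simp
    then have "absval (entire_eval U w) = absval (entire_eval F z) * absval (w - a) ^ k"
      by (simp add: absval_mult absval_power)
    also have "\<dots> \<le> max BF BU * max 1 (absval w) ^ k"
    proof (intro mult_mono power_mono)
      show "absval (entire_eval F z) \<le> max BF BU"
        using entire_eval_le[OF F z(1) BF(2)] by simp
      show "absval (w - a) \<le> max 1 (absval w)"
        using False S by (intro absval_diff_le) auto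
    qed (use BF in auto)
    finally show ?thesis .
  qed
  then have "U $ n = 0" if "k < n" for n using Liouville_nonarch[OF U _ that] by blast
  then have "U = fps_of_poly (truncate_fps (Suc k) U)" by (auto simp: fps_eq_iff)
  moreover have "degree (truncate_fps (Suc k) U) \<le> k" using degree_truncate_fps[of "Suc k" U] by simp
  ultimately show ?thesis by (rule that)
qed

lemma linear_rational_of_poly:
  "a \<noteq> 0 \<Longrightarrow> linear_rational (Fract (fps_of_poly [:b, a:]) (1 :: 'a fps))"
  unfolding linear_rational_def
  by (intro exI[of _ a] exI[of _ b] exI[of _ 0] exI[of _ 1]) (simp flip: one_pCons)

theorem prime_entire:
  fixes F :: "'a fps"
  assumes F: "F \<in> entire" and npoly: "F \<notin> range fps_of_poly"
    and mult: "\<forall>\<beta> x y. multiple_zero (F - fps_const \<beta>) x \<longrightarrow> multiple_zero (F - fps_const \<beta>) y \<longrightarrow> x = y"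
  shows "prime_meromorphic (Fract F 1)"
  unfolding prime_meromorphic_def
proof (intro conjI ballI impI)
  show "Fract F 1 \<in> meromorphic_Cp"
    using F unfolding meromorphic_Cp_def by (intro CollectI exI[of _ F] exI[of _ 1]) simp
  fix f g assume f: "f \<in> meromorphic_Cp" and g: "g \<in> meromorphic_Cp"
    and comp: "is_composition (Fract F 1) f g"
  have nconst: "F \<notin> range fps_const" using npoly by (auto simp flip: fps_of_poly_const)
  have cmp: "mero_eval f w = Some (entire_eval F z)" if "mero_eval g z = Some w" for z w
    using comp that mero_eval_entire[OF F] unfolding is_composition_def by metis
  have not_const: False if "\<And>z w. mero_eval g z = Some w \<Longrightarrow> entire_eval F z = c" for c
  proof -
    have "F - fps_const c = 0" using that F by (intro mero_identity[OF g]) auto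
    then show False using nconst by auto
  qed
  have g_nconst: "g \<noteq> Fract (fps_const c) 1" for c
  proof
    assume "g = Fract (fps_const c) 1"
    then have gc: "mero_eval g z = Some c" for z by (simp add: mero_eval_entire)
    have "entire_eval F z = entire_eval F 0" for z using cmp[OF gc[of z]] cmp[OF gc[of 0]] by simp
    then show False using not_const by blast
  qed
  show "linear_rational f \<or> linear_rational g"
  proof (cases "\<exists>b. mero_eval g b = None")
    case False
    then have "mero_eval g z \<noteq> None" for z by simp
    then obtain G where G: "G \<in> entire" "g = Fract G 1" using mero_no_poles_entire[OF g] by blast
    have "G \<notin> range fps_const" using g_nconst G(2) by blast
    then have surj: "\<exists>z. entire_eval G z = w" for w using entire_surj[OF G(1)] by metis
    have gz: "mero_eval g z = Some (entire_eval G z)" for z unfolding G(2) by (rule mero_eval_entire[OF G(1)])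
    have "mero_eval f w \<noteq> None" for w
      using surj[of w] cmp[OF gz] by force
    then obtain H where H: "H \<in> entire" "f = Fract H 1" using mero_no_poles_entire[OF f] by blast
    have FH: "entire_eval F z = entire_eval H (entire_eval G z)" for z
      using cmp[OF gz] mero_eval_entire[OF H(1)] H(2) by simp
    then obtain a b where "a \<noteq> 0" "H = fps_of_poly [:b, a:] \<or> G = fps_of_poly [:b, a:]"
      using entire_composition_trivial[OF F H(1) G(1) FH npoly mult] by blast
    then show ?thesis using linear_rational_of_poly H(2) G(2) by blast
  next
    case True
    then obtain b where b: "mero_eval g b = None" by blast
    have "\<exists>a. mero_eval f a = None"
    proof (rule ccontr)
      assume "\<nexists>a. mero_eval f a = None"
      then have "mero_eval f z \<noteq> None" for z by simp
      then obtain U where U: "U \<in> entire" "f = Fract U 1" using mero_no_poles_entire[OF f] by blast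
      then have "f = Fract U ((fps_X - fps_const 0) ^ 0)" by simp
      then obtain P where P: "U = fps_of_poly P" "degree P \<le> 0"
        using entire_factor_of_entire_composition[OF F g comp nconst b U(1)] by metis
      then obtain c where "P = [:c:]" using degree_0_id[of P] by (metis le_zero_eq)
      then have "mero_eval f w = Some c" for w unfolding U(2) P(1) by (simp add: mero_eval_entire)
      then show False using not_const[of c] cmp by (metis option.inject)
    qed
    then obtain a where a: "mero_eval f a = None" by blast
    let ?L = "fps_X - fps_const a"
    have omit: "mero_eval g z \<noteq> Some a" for z using cmp[of z a] a by auto
    obtain u v where uv: "u \<in> entire" "v \<in> entire" "v \<noteq> 0" "g = Fract u v"
      using g unfolding meromorphic_Cp_def by blast
    \<comment> \<open>\<open>v / D\<close> is 1 / (g - a). It has no poles: g omits a, and at a pole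
      of g its value is 0.\<close>
    define D where "D = u - fps_const a * v"
    have D: "D \<in> entire" using uv by (simp add: D_def)
    have D0: "D \<noteq> 0"
    proof
      assume "D = 0"
      then have "g = Fract (fps_const a) 1" using uv by (simp add: D_def eq_fract)
      with g_nconst show False by blast
    qed
    have "mero_eval (Fract v D) z \<noteq> None" for z
    proof -
      \<comment> \<open>P / Q is another representation of g; then Q / (P - a Q) represents
        \<open>v / D\<close> with a denominator that does not vanish at z. This treats poles and
        finite values of g alike.\<close>
      have rep: "mero_eval (Fract v D) z \<noteq> None"
        if PQ: "P \<in> entire" "Q \<in> entire" "u * Q = P * v"
          and nz: "entire_eval P z - a * entire_eval Q z \<noteq> 0" for P Q
      proof -
        let ?E = "P - fps_const a * Q"
        have E: "?E \<in> entire" "entire_eval ?E z \<noteq> 0" using PQ nz by auto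
        then have "?E \<noteq> 0" by auto
        moreover have "v * ?E = Q * D"
          using PQ(3) by (simp add: D_def algebra_simps)
        ultimately have "Fract v D = Fract Q ?E" using D0 by (simp add: eq_fract)
        then show ?thesis using mero_eval_Fract[OF PQ(2) E] by simp
      qed
      show ?thesis
      proof (cases "mero_eval g z")
        case None
        obtain k P Q where kPQ: "0 < k" "P \<in> entire" "Q \<in> entire" "entire_eval P z \<noteq> 0"
          "entire_eval Q z \<noteq> 0" "g = Fract P ((fps_X - fps_const z) ^ k * Q)"
          using pole_form[OF g None] by blast
        let ?Q = "(fps_X - fps_const z) ^ k * Q"
        have "Q \<noteq> 0" using kPQ(5) by auto
        then have Q0: "?Q \<noteq> 0" by simp
        have eq: "u * ?Q = P * v" using kPQ(6) unfolding uv(4) Fract_eq_iff[OF uv(3) Q0] .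
        show ?thesis
        proof (rule rep[OF kPQ(2) _ eq])
          show "?Q \<in> entire" using kPQ(3) by simp
          show "entire_eval P z - a * entire_eval ?Q z \<noteq> 0" using kPQ by (simp add: zero_power)
        qed
      next
        case (Some w)
        then have "mero_value (Fract u v) z w" using uv(4) mero_eval_eq_Some by blast
        then obtain P Q where PQ: "P \<in> entire" "Q \<in> entire" "entire_eval Q z \<noteq> 0"
          "w = entire_eval P z / entire_eval Q z" "u * Q = P * v"
          using mero_value_cross[OF uv(1-3)] by metis
        have "w \<noteq> a" using omit Some by blast
        then have nz: "entire_eval P z - a * entire_eval Q z \<noteq> 0" using PQ(3,4) by auto
        show ?thesis by (rule rep[OF PQ(1,2,5) nz])
      qed
    qed
    moreover have "Fract v D \<in> meromorphic_Cp"
      using uv D D0 unfolding meromorphic_Cp_def by blast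
    ultimately obtain h where h: "h \<in> entire" "Fract v D = Fract h 1"
      using mero_no_poles_entire by blast
    have vh: "v = h * D" using h(2) D0 by (simp add: eq_fract)
    then have h0: "h \<noteq> 0" using uv(3) by auto
    have "u * h = (fps_const a * h + 1) * v"
    proof -
      have "u = D + fps_const a * v" by (simp add: D_def)
      then have "u * h = h * D + fps_const a * v * h" by (simp add: algebra_simps)
      then show ?thesis using vh by (simp add: algebra_simps)
    qed
    then have gh: "g = Fract (fps_const a * h + 1) h" using uv h0 by (simp add: eq_fract)
    have h_nconst: "h \<notin> range fps_const"
    proof
      assume "h \<in> range fps_const"
      then obtain c where c: "h = fps_const c" by blast
      then have "c \<noteq> 0" using h0 by auto
      then have "g = Fract (fps_const ((a * c + 1) / c)) 1"
        unfolding gh using c h0 by (simp add: eq_fract flip: fps_const_1_eq_1)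
      with g_nconst show False by blast
    qed
    have gz: "mero_eval g z = Some (a + inverse (entire_eval h z))" if "entire_eval h z \<noteq> 0" for z
      unfolding gh using mero_eval_Fract[OF _ h(1) that, of "fps_const a * h + 1"] h(1) that
      by (simp add: field_simps)
    \<comment> \<open>Since h attains every nonzero value, g attains every value other than a, and
      there f takes a finite value of F.\<close>
    have f_np: "mero_eval f w \<noteq> None" if "w \<noteq> a" for w
    proof -
      obtain z where z: "entire_eval h z = inverse (w - a)" using entire_surj[OF h(1) h_nconst] by blast
      then have "mero_eval g z = Some w" using gz[of z] that by simp
      then show ?thesis using cmp by simp
    qed
    obtain k u1 v1 where k: "0 < k" and u1: "u1 \<in> entire" "v1 \<in> entire" "entire_eval v1 a \<noteq> 0"
      "f = Fract u1 (?L ^ k * v1)"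
      using pole_form[OF f a] by blast
    have v1: "v1 \<noteq> 0" using u1(3) by auto
    have Lk: "?L ^ k \<noteq> 0" "?L ^ k \<in> entire" by simp_all
    \<comment> \<open>Dropping \<open>?L ^ k\<close> removes the pole at a, and f has no other, so
      the remaining quotient is entire.\<close>
    have "mero_eval (Fract u1 v1) w \<noteq> None" for w
    proof (cases "w = a")
      case True
      then show ?thesis using mero_eval_Fract[OF u1(1-3)] by simp
    next
      case False
      then obtain y where "mero_eval f w = Some y" using f_np by blast
      then have "mero_value (Fract u1 (?L ^ k * v1)) w y" using u1(4) mero_eval_eq_Some by blast
      moreover have "?L ^ k * v1 \<in> entire" "?L ^ k * v1 \<noteq> 0" using u1 v1 Lk by (simp_all del: mult_eq_0_iff add: mult_eq_0_iff[of _ v1])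
      ultimately obtain P Q where PQ: "P \<in> entire" "Q \<in> entire" "entire_eval Q w \<noteq> 0" "Q \<noteq> 0"
        "u1 * Q = P * (?L ^ k * v1)"
        using mero_value_cross[OF u1(1), of "?L ^ k * v1" w y] by metis
      have "Fract u1 v1 = Fract (P * ?L ^ k) Q"
        unfolding Fract_eq_iff[OF v1 PQ(4)] using PQ(5) by (simp only: mult.assoc)
      then show ?thesis using mero_eval_Fract[of "P * ?L ^ k" Q w] PQ by simp
    qed
    moreover have "Fract u1 v1 \<in> meromorphic_Cp" using u1 v1 unfolding meromorphic_Cp_def by blast
    ultimately obtain U where U: "U \<in> entire" "Fract u1 v1 = Fract U 1"
      using mero_no_poles_entire by blast
    have "u1 = U * v1" using U(2) v1 by (simp add: eq_fract)
    then have fU: "f = Fract U (?L ^ k)"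
      using u1(4) v1 Lk by (simp add: eq_fract)
    obtain P where P: "U = fps_of_poly P" "degree P \<le> k"
      using entire_factor_of_entire_composition[OF F g comp nconst b U(1) fU] by blast
    define Q where "Q = pcompose P [:a, 1:]"
    have degQ: "degree Q \<le> k" using P(2) degree_pcompose_le[of P "[:a, 1:]"] by (simp add: Q_def)
    have QP: "poly Q s = poly P (a + s)" for s by (simp add: Q_def poly_pcompose)
    text \<open>\<open>T\<close> is the polynomial \<open>f (a + 1 / t)\<close> in \<open>t\<close>.\<close>
    define T where "T = (\<Sum>j\<le>k. monom (coeff Q j) (k - j))"
    have T: "poly T (inverse s) * s ^ k = poly P (a + s)" if "s \<noteq> 0" for s
    proof -
      have "poly T (inverse s) * s ^ k = (\<Sum>j\<le>k. coeff Q j * (inverse s ^ (k - j) * s ^ k))"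
        by (simp add: T_def poly_sum poly_monom sum_distrib_right mult.assoc)
      also have "\<dots> = (\<Sum>j\<le>k. coeff Q j * s ^ j)"
      proof (intro sum.cong refl)
        fix j assume "j \<in> {..k}"
        then have "s ^ k = s ^ (k - j) * s ^ j" by (simp flip: power_add)
        then show "coeff Q j * (inverse s ^ (k - j) * s ^ k) = coeff Q j * s ^ j"
          using that by (simp add: power_inverse)
      qed
      also have "\<dots> = poly Q s" 
        unfolding poly_altdef using degQ by (intro sum.mono_neutral_right) (auto simp: coeff_eq_0)
      finally show ?thesis by (simp add: QP)
    qed
    obtain C where C: "C \<in> entire" "\<And>z. entire_eval C z = poly T (entire_eval h z)"
      using entire_poly_compose[OF h(1)] by blast
    \<comment> \<open>The zeros of h are the poles of g, where the composition says nothing; the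
      factor h covers them.\<close>
    have "entire_eval ((F - C) * h) z = 0" for z
    proof (cases "entire_eval h z = 0")
      case False
      define t where "t = entire_eval h z"
      have t: "t \<noteq> 0" using False by (simp add: t_def)
      have "mero_eval f (a + inverse t) = Some (poly P (a + inverse t) / (inverse t) ^ k)"
        unfolding fU P(1) using mero_eval_Fract[of "fps_of_poly P" "?L ^ k" "a + inverse t"] t by simp
      moreover have "mero_eval f (a + inverse t) = Some (entire_eval F z)"
        using cmp[OF gz[OF False]] by (simp add: t_def)
      ultimately have "entire_eval F z = poly P (a + inverse t) / (inverse t) ^ k" by simp
      also have "\<dots> = poly T t" using T[of "inverse t"] t by (simp add: field_simps)
      finally show ?thesis using F C h(1) by (simp add: t_def)
    qed (use F C h in simp)
    then have "(F - C) * h = 0" using F C(1) h(1) by (intro entire_eq_0) auto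
    then have "F = C" using h0 by simp
    then have Fz: "entire_eval F z = poly T (entire_eval h z)" for z using C(2) by simp
    have FT: "entire_eval F z = entire_eval (fps_of_poly T) (entire_eval h z)" for z
      using Fz by simp
    then obtain c d where c: "c \<noteq> 0" "fps_of_poly T = fps_of_poly [:d, c:] \<or> h = fps_of_poly [:d, c:]"
      using entire_composition_trivial[OF F entire_of_poly h(1) FT npoly mult] by blast
    have "h \<noteq> fps_of_poly [:d, c:]"
    proof
      assume "h = fps_of_poly [:d, c:]"
      then have "F = fps_of_poly (pcompose T [:d, c:])"
        using F Fz by (intro entire_eqI) (simp_all add: poly_pcompose)
      with npoly show False by blast
    qed
    then have T1: "T = [:d, c:]" using c(2) by (simp add: fps_of_poly_eq_iff)
    \<comment> \<open>This is f(w) = d + c / (w - a) without denominators; at w = a both sides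
      vanish since k is positive. As a linear rational function it has determinant - c.\<close>
    have "U * ?L = fps_of_poly [:c - d * a, d:] * ?L ^ k"
    proof (rule entire_eqI)
      fix w
      show "entire_eval (U * ?L) w = entire_eval (fps_of_poly [:c - d * a, d:] * ?L ^ k) w"
      proof (cases "w = a")
        case False
        then have "w - a \<noteq> 0" by simp
        have "poly P w = poly T (inverse (w - a)) * (w - a) ^ k" using T[OF \<open>w - a \<noteq> 0\<close>] by simp
        then have "poly P w * (w - a) = (d * (w - a) + c) * (w - a) ^ k"
          using \<open>w - a \<noteq> 0\<close> by (simp add: T1 field_simps)
        then show ?thesis by (simp add: P(1) algebra_simps)
      qed (use U(1) k in simp)
    qed (use U(1) in simp_all)
    then have "f = Fract (fps_of_poly [:c - d * a, d:]) ?L"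
      unfolding fU Fract_eq_iff[OF Lk(1) linear_nz] .
    also have "?L = fps_of_poly [:- a, 1:]" by (simp add: fps_of_poly_linear)
    finally have "linear_rational f"
      unfolding linear_rational_def using c(1)
      by (intro exI[of _ d] exI[of _ "c - d * a"] exI[of _ 1] exI[of _ "- a"]) simp
    then show ?thesis ..
  qed
qed

end

section \<open>The field \<open>\<complex>\<^sub>p\<close> is algebraically closed\<close>

lemma poly_bound_disc:
  fixes q :: "'a::nonarch_complete_field poly"
  obtains K where "0 < K" "\<And>x. absval x \<le> B \<Longrightarrow> absval (poly q x) \<le> K"
proof -
  have "\<exists>K>0. \<forall>x. absval x \<le> B \<longrightarrow> absval (poly q x) \<le> K"
  proof (induction q)
    case (pCons a q)
    then obtain K where K: "0 < K" "\<And>x. absval x \<le> B \<Longrightarrow> absval (poly q x) \<le> K" by blast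
    have "absval (poly (pCons a q) x) \<le> max (absval a) (max 1 B * K)" if "absval x \<le> B" for x
    proof -
      have "absval (x * poly q x) \<le> max 1 B * K"
        unfolding absval_mult using that K by (intro mult_mono) auto
      then show ?thesis by (simp, intro absval_add_le) auto
    qed
    moreover have "0 < max (absval a) (max 1 B * K)" using K(1) by (simp add: less_max_iff_disj)
    ultimately show ?case by blast
  qed (auto intro: exI[of _ 1])
  then show ?thesis using that by blast
qed

lemma poly_Lipschitz_disc:
  fixes q :: "'a::nonarch_complete_field poly"
  obtains L where "0 < L"
    "\<And>x y. absval x \<le> B \<Longrightarrow> absval y \<le> B \<Longrightarrow> absval (poly q x - poly q y) \<le> L * absval (x - y)"
proof -
  have "\<exists>L>0. \<forall>x y. absval x \<le> B \<longrightarrow> absval y \<le> B \<longrightarrow> absval (poly q x - poly q y) \<le> L * absval (x - y)"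
  proof (induction q)
    case (pCons a q)
    then obtain L where L: "0 < L"
      "\<And>x y. absval x \<le> B \<Longrightarrow> absval y \<le> B \<Longrightarrow> absval (poly q x - poly q y) \<le> L * absval (x - y)" by blast
    obtain K where K: "0 < K" "\<And>x. absval x \<le> B \<Longrightarrow> absval (poly q x) \<le> K" by (rule poly_bound_disc[of B q]) blast
    define M where "M = max K (max 1 B * L)"
    have "absval (poly (pCons a q) x - poly (pCons a q) y) \<le> M * absval (x - y)"
      if xy: "absval x \<le> B" "absval y \<le> B" for x y
    proof -
      have "poly (pCons a q) x - poly (pCons a q) y = x * (poly q x - poly q y) + (x - y) * poly q y"
        by (simp add: algebra_simps)
      moreover have "absval (x * (poly q x - poly q y)) \<le> M * absval (x - y)"
      proof -
        have "absval (x * (poly q x - poly q y)) \<le> max 1 B * (L * absval (x - y))"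
          unfolding absval_mult using xy L(2)[OF xy] by (intro mult_mono) auto
        also have "\<dots> = (max 1 B * L) * absval (x - y)" by simp
        also have "\<dots> \<le> M * absval (x - y)" by (intro mult_right_mono) (auto simp: M_def)
        finally show ?thesis .
      qed
      moreover have "absval ((x - y) * poly q y) \<le> M * absval (x - y)"
      proof -
        have "absval (poly q y) \<le> M" using K(2)[OF xy(2)] by (simp add: M_def)
        from mult_left_mono[OF this, of "absval (x - y)"] show ?thesis
          by (simp add: absval_mult mult.commute)
      qed
      ultimately show ?thesis using absval_add_le by metis
    qed
    moreover have "0 < M" using K(1) by (simp add: M_def less_max_iff_disj)
    ultimately show ?case by blast
  qed (auto intro: exI[of _ 1])
  then show ?thesis using that by blast
qed

text \<open>Uniform strict differentiability: the derivative is taken at one centre z while x and y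
  vary within distance r of it. This makes the Newton map below a contraction.\<close>

lemma poly_second_order_disc:
  fixes q :: "'a::nonarch_complete_field poly"
  obtains K where "0 < K"
    "\<And>x y z r. absval x \<le> B \<Longrightarrow> absval y \<le> B \<Longrightarrow> absval z \<le> B \<Longrightarrow> absval (x - z) \<le> r \<Longrightarrow> absval (y - z) \<le> r \<Longrightarrow>
       absval (poly q x - poly q y - poly (pderiv q) z * (x - y)) \<le> K * r * absval (x - y)"
proof -
  have "\<exists>K>0. \<forall>x y z r. absval x \<le> B \<longrightarrow> absval y \<le> B \<longrightarrow> absval z \<le> B \<longrightarrow> absval (x - z) \<le> r \<longrightarrow> absval (y - z) \<le> r \<longrightarrow>
       absval (poly q x - poly q y - poly (pderiv q) z * (x - y)) \<le> K * r * absval (x - y)"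
  proof (induction q)
    case 0
    have "0 \<le> r" if "absval (x - z) \<le> r" for x z :: 'a and r using that absval_nonneg[of "x - z"] by linarith
    then show ?case by (auto intro!: exI[of _ 1])
  next
    case (pCons a q)
    then obtain K where K: "0 < K" "\<And>x y z r. absval x \<le> B \<Longrightarrow> absval y \<le> B \<Longrightarrow> absval z \<le> B \<Longrightarrow>
       absval (x - z) \<le> r \<Longrightarrow> absval (y - z) \<le> r \<Longrightarrow>
       absval (poly q x - poly q y - poly (pderiv q) z * (x - y)) \<le> K * r * absval (x - y)" by blast
    obtain L where L: "0 < L"
      "\<And>x y. absval x \<le> B \<Longrightarrow> absval y \<le> B \<Longrightarrow> absval (poly q x - poly q y) \<le> L * absval (x - y)"
      by (rule poly_Lipschitz_disc[of B q]) blast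
    define M where "M = max L (max 1 B * K)"
    have M: "0 < M" "L \<le> M" "max 1 B * K \<le> M" using L(1) by (auto simp: M_def)
    have "absval (poly (pCons a q) x - poly (pCons a q) y - poly (pderiv (pCons a q)) z * (x - y)) \<le> M * r * absval (x - y)"
      if xyz: "absval x \<le> B" "absval y \<le> B" "absval z \<le> B" "absval (x - z) \<le> r" "absval (y - z) \<le> r" for x y z r
    proof -
      have r: "0 \<le> r" using xyz(4) absval_nonneg[of "x - z"] by linarith
      have eq: "poly (pCons a q) x - poly (pCons a q) y - poly (pderiv (pCons a q)) z * (x - y) =
        z * (poly q x - poly q y - poly (pderiv q) z * (x - y)) +
        ((x - z) * (poly q x - poly q y) + (x - y) * (poly q y - poly q z))"
        by (simp add: pderiv_pCons algebra_simps)
      have 1: "absval (z * (poly q x - poly q y - poly (pderiv q) z * (x - y))) \<le> M * r * absval (x - y)"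
      proof -
        have "absval (z * (poly q x - poly q y - poly (pderiv q) z * (x - y))) \<le> max 1 B * (K * r * absval (x - y))"
          unfolding absval_mult[of z] using xyz K(2)[OF xyz] by (intro mult_mono) auto
        also have "\<dots> = (max 1 B * K) * (r * absval (x - y))" by simp
        also have "\<dots> \<le> M * (r * absval (x - y))" using r M by (intro mult_right_mono) auto
        finally show ?thesis by (simp add: mult.assoc)
      qed
      have 2: "absval ((x - z) * (poly q x - poly q y)) \<le> M * r * absval (x - y)"
      proof -
        have "absval ((x - z) * (poly q x - poly q y)) \<le> r * (L * absval (x - y))"
          unfolding absval_mult using xyz L(2)[OF xyz(1,2)] r by (intro mult_mono) auto
        also have "\<dots> = L * (r * absval (x - y))" by simp
        also have "\<dots> \<le> M * (r * absval (x - y))" using r M by (intro mult_right_mono) auto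
        finally show ?thesis by (simp add: mult.assoc)
      qed
      have 3: "absval ((x - y) * (poly q y - poly q z)) \<le> M * r * absval (x - y)"
      proof -
        have "absval (poly q y - poly q z) \<le> L * absval (y - z)" by (rule L(2)[OF xyz(2,3)])
        also have "\<dots> \<le> M * r" using M L(1) xyz(5) r by (intro mult_mono) auto
        finally have "absval (poly q y - poly q z) \<le> M * r" .
        from mult_left_mono[OF this, of "absval (x - y)"] show ?thesis
          by (simp add: absval_mult mult.commute)
      qed
      show ?thesis unfolding eq by (intro absval_add_le 1 2 3)
    qed
    then show ?case using M(1) by blast
  qed
  then show ?thesis using that by blast
qed

text \<open>The Newton map uses the derivative frozen at the starting point z and contracts a small
  closed ball around z, so Banach's theorem applies. The threshold depends only on \<delta>, B and
  q, not on the starting point.\<close>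

lemma Newton_root:
  fixes q :: "'a::nonarch_complete_field poly"
  assumes "0 < \<delta>"
  obtains e where "0 < e"
    "\<And>x. absval x \<le> B \<Longrightarrow> \<delta> \<le> absval (poly (pderiv q) x) \<Longrightarrow> absval (poly q x) < e \<Longrightarrow> \<exists>y. poly q y = 0"
proof -
  define B' where "B' = max 1 B"
  obtain K where K: "0 < K" "\<And>x y z r. absval x \<le> B' \<Longrightarrow> absval y \<le> B' \<Longrightarrow> absval z \<le> B' \<Longrightarrow>
      absval (x - z) \<le> r \<Longrightarrow> absval (y - z) \<le> r \<Longrightarrow>
      absval (poly q x - poly q y - poly (pderiv q) z * (x - y)) \<le> K * r * absval (x - y)"
    by (rule poly_second_order_disc[of B' q]) blast
  \<comment> \<open>The bound by 1 keeps the ball inside the disc of radius B'; the other bound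
    makes the contraction constant 1/2. A value below \<delta> * \<rho> at z makes the first step at
    most \<rho>.\<close>
  define \<rho> where "\<rho> = min 1 (\<delta> / (2 * K))"
  have \<rho>: "0 < \<rho>" "\<rho> \<le> 1" using assms K(1) by (auto simp: \<rho>_def)
  have "\<rho> \<le> \<delta> / (2 * K)" by (simp add: \<rho>_def)
  then have K\<rho>: "K * \<rho> \<le> \<delta> / 2" using K(1) by (simp add: pos_le_divide_eq mult_ac)
  have "\<exists>y. poly q y = 0"
    if z: "absval z \<le> B" "\<delta> \<le> absval (poly (pderiv q) z)" "absval (poly q z) < \<delta> * \<rho>" for z
  proof -
    define c where "c = poly (pderiv q) z"
    have c: "\<delta> \<le> absval c" "c \<noteq> 0" using z(2) assms by (auto simp: c_def)
    define T where "T x = x - poly q x / c" for x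
    have zB: "absval z \<le> B'" using z(1) by (simp add: B'_def)
    have xB: "absval x \<le> B'" if "absval (x - z) \<le> \<rho>" for x
    proof -
      have "absval (z + (x - z)) \<le> B'" using zB that \<rho> by (intro absval_add_le) (auto simp: B'_def)
      then show ?thesis by simp
    qed
    have lip: "absval (T x - T y) \<le> 1 / 2 * absval (x - y)" if xy: "absval (x - z) \<le> \<rho>" "absval (y - z) \<le> \<rho>" for x y
    proof -
      have "T x - T y = - ((poly q x - poly q y - c * (x - y)) / c)"
        using c(2) by (simp add: T_def field_simps)
      then have "absval (T x - T y) = absval (poly q x - poly q y - c * (x - y)) / absval c"
        by (simp add: absval_divide)
      also have "\<dots> \<le> (K * \<rho> * absval (x - y)) / absval c"
        unfolding c_def using xy by (intro divide_right_mono K(2) xB zB) auto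
      also have "\<dots> \<le> (\<delta> / 2 * absval (x - y)) / \<delta>"
        using K\<rho> K(1) \<rho>(1) c(1) assms by (intro frac_le mult_right_mono) auto
      also have "\<dots> = 1 / 2 * absval (x - y)" using assms by simp
      finally show ?thesis .
    qed
    have "\<exists>!x\<in>cball z \<rho>. T x = x"
    proof (rule Banach_fix[where c = "1 / 2"])
      show "complete (cball z \<rho>)" by (simp add: complete_eq_closed)
      show "cball z \<rho> \<noteq> {}" using \<rho> by simp
      show "T ` cball z \<rho> \<subseteq> cball z \<rho>"
      proof
        fix y assume "y \<in> T ` cball z \<rho>"
        then obtain x where x: "absval (x - z) \<le> \<rho>" "y = T x"
          by (auto simp: dist_absval absval_minus_commute[of z])
        have "absval (T x - T z) \<le> \<rho>" using lip[OF x(1), of z] \<rho>(1) x(1) by simp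
        moreover have "absval (T z - z) \<le> \<rho>"
        proof -
          have "absval (T z - z) = absval (poly q z) / absval c" by (simp add: T_def absval_divide)
          also have "\<dots> \<le> (\<delta> * \<rho>) / \<delta>" using z(3) c(1) assms \<rho>(1) by (intro frac_le) auto
          finally show ?thesis using assms by simp
        qed
        ultimately have "absval ((T x - T z) + (T z - z)) \<le> \<rho>" by (rule absval_add_le)
        then show "y \<in> cball z \<rho>" using x(2) by (simp add: dist_absval absval_minus_commute[of z])
      qed
    qed (use lip in \<open>auto simp: dist_absval absval_minus_commute[of z]\<close>)
    then obtain x where "T x = x" by blast
    then show ?thesis using c(2) by (auto simp: T_def)
  qed
  moreover have "0 < \<delta> * \<rho>" using assms \<rho>(1) by simp
  ultimately show ?thesis using that by blast
qed

text \<open>In a product of linear factors the one of the nearest root is smallest, so c is a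
  nearest root to x. Roots are assumed only up to degree d because the lemma is used inside an
  induction on the degree.\<close>

lemma root_near_small_value:
  fixes r :: "'a::nonarch_complete_field poly"
  assumes roots: "\<And>s::'a poly. 0 < degree s \<Longrightarrow> degree s \<le> d \<Longrightarrow> \<exists>x. poly s x = 0"
    and "0 < degree r" "degree r \<le> d"
  shows "\<exists>c. poly r c = 0 \<and> absval (lead_coeff r) * absval (x - c) ^ degree r \<le> absval (poly r x)"
  using assms(2-)
proof (induction "degree r" arbitrary: r)
  case (Suc n)
  obtain c where c: "poly r c = 0" using roots[OF Suc.prems] by blast
  then obtain r1 where r1: "r = [:- c, 1:] * r1" using poly_eq_0_iff_dvd by (metis dvdE)
  have "r1 \<noteq> 0" using r1 Suc.prems by auto
  then have deg: "degree r = Suc (degree r1)" unfolding r1 by (subst degree_mult_eq) auto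
  have lead: "lead_coeff r = lead_coeff r1" unfolding r1 lead_coeff_mult by simp
  have val: "absval (poly r x) = absval (x - c) * absval (poly r1 x)"
    unfolding r1 poly_mult absval_mult by simp
  show ?case
  proof (cases "degree r1 = 0")
    case True
    then obtain l where "r1 = [:l:]" using degree_0_id by metis
    then show ?thesis using c val lead deg by (intro exI[of _ c]) (simp add: mult.commute)
  next
    case False
    then obtain c1 where c1: "poly r1 c1 = 0" "absval (lead_coeff r1) * absval (x - c1) ^ degree r1 \<le> absval (poly r1 x)"
      using Suc.hyps(1)[of r1] Suc.hyps(2) Suc.prems(2) deg by auto
    define e where "e = min (absval (x - c)) (absval (x - c1))"
    have e: "0 \<le> e" "e \<le> absval (x - c)" "e \<le> absval (x - c1)" by (auto simp: e_def)
    have "absval (lead_coeff r) * e ^ degree r = e * (absval (lead_coeff r1) * e ^ degree r1)"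
      unfolding lead unfolding deg by (simp add: mult_ac)
    also have "\<dots> \<le> absval (x - c) * (absval (lead_coeff r1) * absval (x - c1) ^ degree r1)"
      using e by (intro mult_mono power_mono) auto
    also have "\<dots> \<le> absval (poly r x)" unfolding val using c1(2) by (intro mult_left_mono) auto
    finally have "absval (lead_coeff r) * e ^ degree r \<le> absval (poly r x)" .
    moreover have "poly r c1 = 0" using c1 by (simp add: r1)
    moreover have "e = absval (x - c) \<or> e = absval (x - c1)" by (auto simp: e_def)
    ultimately show ?thesis using c by metis
  qed
qed simp

text \<open>Approximate the coefficients of q by elements of S; the resulting polynomial has a root
  in S, and q is small there. The point is that one B bounds these roots for all precisions.\<close>

lemma approximate_roots:
  fixes q :: "'a::nonarch_complete_field poly"
  assumes closed: "algebraically_closed_subset S" and dense: "closure S = (UNIV :: 'a set)" and deg: "0 < degree q"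
  obtains B where "\<And>e. 0 < e \<Longrightarrow> \<exists>x. absval x \<le> B \<and> absval (poly q x) < e"
proof -
  define n where "n = degree q"
  define C where "C = 1 + (\<Sum>i\<le>n. absval (coeff q i))"
  define l where "l = absval (lead_coeff q)"
  have l: "0 < l" using deg by (auto simp: l_def)
  have C: "1 \<le> C" by (simp add: C_def sum_nonneg)
  \<comment> \<open>If |x| exceeds 1 and C / l, the leading term outweighs all others, since their
    coefficients are at most C.\<close>
  define B where "B = max 1 (C / l)"
  have B: "1 \<le> B" "C / l \<le> B" by (auto simp: B_def)
  have "\<exists>x. absval x \<le> B \<and> absval (poly q x) < e" if e: "0 < e" for e
  proof -
    \<comment> \<open>Precision l preserves the absolute value of the leading coefficient, precision
      1 keeps the coefficients below C, and the last bound yields a value of q of at most e /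
      2.\<close>
    define \<eta> where "\<eta> = min (min 1 l) (e / (2 * B ^ n))"
    have \<eta>: "0 < \<eta>" "\<eta> \<le> 1" "\<eta> \<le> l" "\<eta> \<le> e / (2 * B ^ n)" using l e B by (auto simp: \<eta>_def)
    have "\<exists>s\<in>S. absval (s - coeff q i) < \<eta>" for i
      using closure_approachable[of "coeff q i" S] dense \<eta>(1) by (auto simp: dist_absval)
    then obtain s where s: "\<And>i. s i \<in> S" "\<And>i. absval (s i - coeff q i) < \<eta>" by metis
    define r where "r = (\<Sum>i\<le>n. monom (s i) i)"
    have cr: "coeff r i = (if i \<le> n then s i else 0)" for i
      by (simp add: r_def coeff_sum)
    have sn: "absval (s n) = l"
    proof -
      have "absval (coeff q n + (s n - coeff q n)) = absval (coeff q n)"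
        using s(2)[of n] \<eta> by (intro absval_add_eq) (simp add: l_def n_def)
      then show ?thesis by (simp add: l_def n_def)
    qed
    then have rn: "coeff r n \<noteq> 0" using l by (auto simp: cr)
    have "degree r \<le> n" by (rule degree_le) (simp add: cr)
    with le_degree[OF rn] rn have degr: "degree r = n" "r \<noteq> 0" by auto
    have "set (coeffs r) \<subseteq> S" using s(1) degr by (auto simp: coeffs_def cr)
    then obtain x where x: "poly r x = 0"
      using closed deg degr n_def unfolding algebraically_closed_subset_def by metis
    have sC: "absval (s i) \<le> C" if "i \<le> n" for i
    proof -
      have "absval (coeff q i) \<le> (\<Sum>i\<le>n. absval (coeff q i))" using that by (intro member_le_sum) auto
      then have "absval (coeff q i + (s i - coeff q i)) \<le> C"
        using s(2)[of i] \<eta>(2) C by (intro absval_add_le) (auto simp: C_def)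
      then show ?thesis by simp
    qed
    have "n \<noteq> 0" using deg by (simp add: n_def)
    then obtain m where m: "n = Suc m" by (cases n) auto
    have xB: "absval x \<le> B"
    proof (rule ccontr)
      assume "\<not> absval x \<le> B"
      then have x1: "1 < absval x" "C / l < absval x" using B by auto
      have "poly r x = s n * x ^ n + (\<Sum>i<n. s i * x ^ i)"
        by (simp add: poly_altdef degr cr lessThan_Suc_atMost[symmetric])
      then have "absval (s n * x ^ n) = absval (\<Sum>i<n. s i * x ^ i)"
        using x by (metis absval_minus add_eq_0_iff)
      also have "\<dots> \<le> C * absval x ^ m"
      proof (rule absval_sum_le)
        fix i assume "i \<in> {..<n}"
        then show "absval (s i * x ^ i) \<le> C * absval x ^ m"
          unfolding absval_mult absval_power using sC[of i] x1 C m
          by (intro mult_mono power_increasing) auto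
      qed (use C in auto)
      finally have "(l * absval x) * absval x ^ m \<le> C * absval x ^ m"
        by (simp add: absval_mult absval_power sn[unfolded m] m mult_ac)
      then have "l * absval x \<le> C" using x1 by (intro mult_right_le_imp_le[of "l * absval x" "absval x ^ m"] zero_less_power; linarith)
      then show False using x1(2) l by (simp add: field_simps)
    qed
    have "poly q x = poly q x - poly r x" using x by simp
    also have "\<dots> = - (\<Sum>i\<le>n. (s i - coeff q i) * x ^ i)"
      by (simp add: poly_altdef degr cr n_def[symmetric] sum_subtractf left_diff_distrib)
    finally have "absval (poly q x) = absval (\<Sum>i\<le>n. (s i - coeff q i) * x ^ i)" by simp
    also have "\<dots> \<le> \<eta> * B ^ n"
    proof (rule absval_sum_le)
      fix i assume i: "i \<in> {..n}"
      have "absval x ^ i \<le> B ^ i" using xB by (intro power_mono) auto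
      also have "\<dots> \<le> B ^ n" using i B by (intro power_increasing) auto
      finally show "absval ((s i - coeff q i) * x ^ i) \<le> \<eta> * B ^ n"
        unfolding absval_mult absval_power using s(2)[of i] \<eta>(1) by (intro mult_mono) auto
    qed (use \<eta>(1) B in auto)
    also have "\<dots> \<le> e / 2" using \<eta>(4) B by (simp add: field_simps)
    also have "\<dots> < e" using e by simp
    finally show ?thesis using xB by blast
  qed
  then show ?thesis using that by blast
qed

text \<open>Approximate roots \<open>x\<close> of \<open>q\<close> come from the dense subset. If \<open>q'\<close> stays away from 0 along them,
  Newton's method converges to a root; otherwise they approach a root of \<open>q'\<close>, which exists by
  induction on the degree, and this root is also a root of \<open>q\<close>.\<close>

theorem closure_alg_closed:
  fixes q :: "'a::nonarch_complete_field poly"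
  assumes closed: "algebraically_closed_subset S" and dense: "closure S = (UNIV :: 'a set)"
  shows "0 < degree q \<Longrightarrow> \<exists>x. poly q x = 0"
proof (induction "degree q" arbitrary: q rule: less_induct)
  case less
  obtain B where B: "\<And>e. 0 < e \<Longrightarrow> \<exists>x. absval x \<le> B \<and> absval (poly q x) < e"
    by (rule approximate_roots[OF closed dense less.prems]) blast
  define D where "D = pderiv q"
  have degD: "degree D = degree q - 1" by (simp add: D_def degree_pderiv)
  show ?case
  proof (cases "\<exists>\<delta>>0. \<forall>e>0. \<exists>x. absval x \<le> B \<and> absval (poly q x) < e \<and> \<delta> \<le> absval (poly D x)")
    case True
    then obtain \<delta> where \<delta>: "0 < \<delta>"
      "\<And>e. 0 < e \<Longrightarrow> \<exists>x. absval x \<le> B \<and> absval (poly q x) < e \<and> \<delta> \<le> absval (poly D x)" by blast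
    obtain e where e: "0 < e"
      "\<And>x. absval x \<le> B \<Longrightarrow> \<delta> \<le> absval (poly (pderiv q) x) \<Longrightarrow> absval (poly q x) < e \<Longrightarrow> \<exists>y. poly q y = 0"
      by (rule Newton_root[OF \<delta>(1), of B q]) blast
    then show ?thesis using \<delta>(2)[OF e(1)] unfolding D_def by blast
  next
    case False
    have small: "\<exists>x. absval x \<le> B \<and> absval (poly q x) < d \<and> absval (poly D x) < d" if "0 < d" for d
    proof -
      have "\<exists>e>0. \<forall>x. absval x \<le> B \<longrightarrow> absval (poly q x) < e \<longrightarrow> absval (poly D x) < d"
        using False that by (meson not_le)
      then obtain e where e: "0 < e" "\<And>x. absval x \<le> B \<Longrightarrow> absval (poly q x) < e \<Longrightarrow> absval (poly D x) < d"
        by blast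
      from e that have "0 < min e d" by simp
      then obtain x where "absval x \<le> B" "absval (poly q x) < min e d" using B by blast
      then show ?thesis using e by auto
    qed
    have "D \<noteq> 0" using less.prems by (auto simp: D_def pderiv_eq_0_iff)
    define l where "l = absval (lead_coeff D)"
    have l: "0 < l" using \<open>D \<noteq> 0\<close> by (simp add: l_def)
    have Dpos: "0 < degree D"
    proof (rule ccontr)
      assume "\<not> 0 < degree D"
      then have "[:coeff D 0:] = D" by (intro degree_0_id) simp
      then obtain c where c: "D = [:c:]" by metis
      then have "0 < absval c" using \<open>D \<noteq> 0\<close> by auto
      from small[OF this] show False by (simp add: c)
    qed
    have IH: "\<exists>x. poly s x = 0" if "0 < degree s" "degree s \<le> degree D" for s :: "'a poly"
      using less.hyps[of s] that less.prems degD by auto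
    show ?thesis
    proof (rule ccontr)
      assume nr: "\<nexists>x. poly q x = 0"
      let ?Z = "{z. poly D z = 0}"
      have Z: "finite ?Z" "?Z \<noteq> {}" using poly_roots_finite[OF \<open>D \<noteq> 0\<close>] IH[OF Dpos] by auto
      define \<mu> where "\<mu> = Min ((\<lambda>z. absval (poly q z)) ` ?Z)"
      have "\<mu> \<in> (\<lambda>z. absval (poly q z)) ` ?Z" unfolding \<mu>_def using Z by (intro Min_in) auto
      then have \<mu>: "0 < \<mu>" using nr by auto
      define B' where "B' = Max (insert B (absval ` ?Z))"
      have B': "B \<le> B'" "\<And>z. poly D z = 0 \<Longrightarrow> absval z \<le> B'"
        unfolding B'_def using Z(1) by (intro Max_ge; simp)+
      obtain L where L: "0 < L"
        "\<And>x y. absval x \<le> B' \<Longrightarrow> absval y \<le> B' \<Longrightarrow> absval (poly q x - poly q y) \<le> L * absval (x - y)"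
        by (rule poly_Lipschitz_disc[of B' q]) blast
      \<comment> \<open>A point x with |D(x)| < d lies within \<mu> / L of a zero c of D. Together
        with |q(x)| < \<mu>, this makes |q(c)| smaller than its minimum \<mu> over those
        zeros.\<close>
      define d where "d = min \<mu> (l * (\<mu> / L) ^ degree D)"
      have "0 < d" using \<mu> L l by (simp add: d_def)
      then obtain x where x: "absval x \<le> B" "absval (poly q x) < d" "absval (poly D x) < d"
        using small by blast
      obtain c where c: "poly D c = 0" "l * absval (x - c) ^ degree D \<le> absval (poly D x)"
        using root_near_small_value[OF IH Dpos order.refl, of x] unfolding l_def by blast
      have "l * absval (x - c) ^ degree D < l * (\<mu> / L) ^ degree D" using c(2) x(3) by (simp add: d_def)
      then have "absval (x - c) ^ degree D < (\<mu> / L) ^ degree D" using l by simp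
      then have "absval (x - c) < \<mu> / L" by (rule power_less_imp_less_base) (use \<mu> L in simp)
      then have "L * absval (x - c) < \<mu>" using L by (simp add: field_simps)
      moreover have "absval (poly q c - poly q x) \<le> L * absval (c - x)"
        using x(1) B' c(1) by (intro L(2)) auto
      ultimately have "absval (poly q c - poly q x) < \<mu>"
        by (simp add: absval_minus_commute[of c x])
      then have "absval (poly q x + (poly q c - poly q x)) < \<mu>"
        using x(2) by (intro absval_add_less) (auto simp: d_def)
      then have "absval (poly q c) < \<mu>" by simp
      moreover have "\<mu> \<le> absval (poly q c)" unfolding \<mu>_def using Z c by (intro Min_le) auto
      ultimately show False by simp
    qed
  qed
qed

section \<open>The field of p-adic complex numbers satisfies the locale assumptions\<close>

text \<open>The prime p itself is the element of absolute value strictly between 0 and 1 that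
  \<open>nontrivial\<close> asks for.\<close>

lemma padic_abs_prime:
  assumes "prime p"
  shows "padic_abs p (of_nat p) = inverse (real p)"
proof -
  have "quotient_of (rat_of_nat p) = (int p, 1)"
    using quotient_of_int[of "int p"] by simp
  moreover have "multiplicity (int p) (int p) = 1"
    using assms by (intro multiplicity_self) auto
  moreover have "p \<noteq> 0" using assms by auto
  ultimately show ?thesis by (simp add: padic_abs_def power_int_minus)
qed

lemma is_Cp_nonarch_alg_closed:
  assumes "prime p" "is_Cp p TYPE('a::nonarch_complete_field)"
  shows "nonarch_alg_closed TYPE('a)"
proof
  have "absval (of_rat (of_nat p) :: 'a) = inverse (real p)"
    using assms padic_abs_prime unfolding is_Cp_def by metis
  moreover have "1 < p" using assms(1) by (rule prime_gt_1_nat)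
  ultimately have "0 < absval (of_rat (of_nat p) :: 'a) \<and> absval (of_rat (of_nat p) :: 'a) < 1"
    by (simp add: inverse_less_1_iff)
  then show "\<exists>\<pi>::'a. 0 < absval \<pi> \<and> absval \<pi> < 1" by blast
  show "\<exists>x. poly q x = 0" if "0 < degree q" for q :: "'a poly"
    using closure_alg_closed[of "algebraic_elements (Qp :: 'a set)" q] assms(2) that
    unfolding is_Cp_def by blast
qed

theorem theorem2p6:
  fixes p :: nat and F :: "'a::nonarch_complete_field fps"
  assumes "prime p"
    and "is_Cp p TYPE('a)"
    and "F \<in> entire - range fps_of_poly"
    and "\<And>\<beta> x y. multiple_zero (F - fps_const \<beta>) x \<Longrightarrow>
           multiple_zero (F - fps_const \<beta>) y \<Longrightarrow> x = y"
  shows "prime_meromorphic (Fract F 1)"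
proof -
  interpret nonarch_alg_closed "TYPE('a)"
    by (rule is_Cp_nonarch_alg_closed[OF assms(1,2)])
  show ?thesis using assms(3,4) by (intro prime_entire) blast+
qed

end
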